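(* Let $K$ be a finite simplicial complex with $m\geq 1$ vertices. Then $\ddot{\mathrm{B}}^{*}_{*}(K)\cong\ddot{\mathrm{B}}^{1}_{0}(K)\neq 0$ (that is, $\ddot{\mathrm{B}}^1_0(K)\neq 0$ and $\ddot{\mathrm{B}}^j_i(K)=0$ for all $(j,i)\neq(1,0)$) if and only if $K\cong\Delta^{m-1}$.
   Context: All homology has coefficients in $\mathbb{Z}$. $K$ has vertex set $V=\{v_1,\dots,v_m\}$ without ghost vertices (every $v_i$ is a $0$-simplex of $K$). $\Delta^{m-1}$ is the full simplex on $m$ vertices. **0-degree überhomology $\ddot{\mathrm{B}}$.** A bicolouring is a map $\varepsilon\colon V\to\{0,1\}$; put $\ell(\varepsilon)=\sum_j\varepsilon(v_j)$. The weight $w_\varepsilon(\sigma)$ of a simplex $\sigma$ is the number of vertices of $\sigma$ coloured $0$. The simplicial differential on $C_*(K;\mathbb{Z})$ splits as a part $\partial_h$ preserving $w_\varepsilon$ and a part lowering it by one; the horizontal homology $\mathrm{H}^h(K,\varepsilon)$ is the homology of $(C_*(K;\mathbb{Z}),\partial_h)$, bigraded by weight and simplex dimension. Set $\ddot{\mathrm{C}}^j(K)=\bigoplus_{\ell(\varepsilon)=j}\mathrm{H}^h(K,\varepsilon)$. If $\varepsilon,\varepsilon'$ differ only at $v_i$, with $\varepsilon(v_i)=0$, $\varepsilon'(v_i)=1$, let $d_{\varepsilon,\varepsilon'}\colon\mathrm{H}^h(K,\varepsilon)\to\mathrm{H}^h(K,\varepsilon')$ be induced by $\sigma\mapsto(-1)^{s}\sigma$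 if $w_\varepsilon(\sigma)=w_{\varepsilon'}(\sigma)$ and $\sigma\mapsto0$ otherwise, where $s=|\{j<i:\varepsilon(v_j)=1\}|$. The differential $\ddot d^j\colon\ddot{\mathrm{C}}^j(K)\to\ddot{\mathrm{C}}^{j+1}(K)$ is the sum of all $d_{\varepsilon,\varepsilon'}$ with $\ell(\varepsilon)=j$; it preserves weight and simplex dimension. $\ddot{\mathrm{H}}^j_{k,i}(K)$ is the part of the degree-$j$ cohomology of $(\ddot{\mathrm{C}}^*(K),\ddot d)$ in weight $k$ and simplex dimension $i$, and $\ddot{\mathrm{B}}^j_i(K):=\ddot{\mathrm{H}}^j_{0,i}(K)$. (Explicitly, in weight $0$ the group attached to $\varepsilon$ is the unreduced homology $\mathrm{H}_i(K[I_\varepsilon])$ of the subcomplex induced on $I_\varepsilon=\varepsilon^{-1}(1)$, with $K[\emptyset]=\emptyset$, and $d_{\varepsilon,\varepsilon'}$ is up to sign the map induced by inclusion.) *)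

theory Defs
  imports "HOL-Algebra.Algebra"
begin

section \<open>Finite simplicial complexes\<close>

text \<open>
  A complex is the family of its simplices, as nonempty vertex sets. Its vertices are the
  elements of its simplices, so there are no ghost vertices.
\<close>

definition finite_simplicial_complex :: "'a set set \<Rightarrow> bool" where
  "finite_simplicial_complex K \<longleftrightarrow>
     finite K \<and> (\<forall>\<sigma>\<in>K. finite \<sigma> \<and> \<sigma> \<noteq> {}) \<and> (\<forall>\<sigma>\<in>K. \<forall>\<tau>. \<tau> \<subseteq> \<sigma> \<and> \<tau> \<noteq> {} \<longrightarrow> \<tau> \<in> K)"

definition vertex_set :: "'a set set \<Rightarrow> 'a set" where
  "vertex_set K = \<Union> K"

definition full_simplex :: "nat \<Rightarrow> nat set set" where
  "full_simplex n = Pow {0..n} - {{}}"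

definition simplicial_isomorphic :: "'a set set \<Rightarrow> 'b set set \<Rightarrow> bool" where
  "simplicial_isomorphic K L \<longleftrightarrow>
     (\<exists>f. bij_betw f (vertex_set K) (vertex_set L) \<and> (\<lambda>\<sigma>. f ` \<sigma>) ` K = L)"

section \<open>Horizontal homology of a bicoloured complex\<close>

text \<open>
  From here on, \<open>v\<close> enumerates the vertices as \<open>v 1, \<dots>, v m\<close> with \<open>m = card (vertex_set K)\<close>,
  that is, \<open>bij_betw v {1..m} (vertex_set K)\<close>. A simplex is oriented by this order.
\<close>

definition bicolourings :: "'a set set \<Rightarrow> ('a \<Rightarrow> nat) set" where
  "bicolourings K = (vertex_set K \<rightarrow>\<^sub>E {0, 1})"

definition colouring_length :: "'a set set \<Rightarrow> ('a \<Rightarrow> nat) \<Rightarrow> nat" where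
  "colouring_length K \<epsilon> = (\<Sum>x\<in>vertex_set K. \<epsilon> x)"

definition weight :: "('a \<Rightarrow> nat) \<Rightarrow> 'a set \<Rightarrow> nat" where
  "weight \<epsilon> \<sigma> = card {x \<in> \<sigma>. \<epsilon> x = 0}"

text \<open>
  The chain complex is not augmented: the empty face is left out, so vertices have boundary 0.
\<close>

definition simplicial_boundary ::
    "'a set set \<Rightarrow> (nat \<Rightarrow> 'a) \<Rightarrow> ('a set \<Rightarrow>\<^sub>0 int) \<Rightarrow> ('a set \<Rightarrow>\<^sub>0 int)" where
  "simplicial_boundary K v =
     frag_extend (\<lambda>\<sigma>. \<Sum>i | i \<in> {1..card (vertex_set K)} \<and> v i \<in> \<sigma> \<and> \<sigma> - {v i} \<noteq> {}.
       frag_cmul ((-1) ^ card {j \<in> {1..<i}. v j \<in> \<sigma>}) (frag_of (\<sigma> - {v i})))"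

definition horizontal_boundary ::
    "'a set set \<Rightarrow> (nat \<Rightarrow> 'a) \<Rightarrow> ('a \<Rightarrow> nat) \<Rightarrow> ('a set \<Rightarrow>\<^sub>0 int) \<Rightarrow> ('a set \<Rightarrow>\<^sub>0 int)" where
  "horizontal_boundary K v \<epsilon> =
     frag_extend (\<lambda>\<sigma>. frag_extend (\<lambda>\<tau>. if weight \<epsilon> \<tau> = weight \<epsilon> \<sigma> then frag_of \<tau> else 0)
       (simplicial_boundary K v (frag_of \<sigma>)))"

text \<open>In all bigraded groups below, \<open>k\<close> is the weight and \<open>n\<close> the simplex dimension.\<close>

definition weight_chain_group ::
    "'a set set \<Rightarrow> ('a \<Rightarrow> nat) \<Rightarrow> nat \<Rightarrow> nat \<Rightarrow> ('a set \<Rightarrow>\<^sub>0 int) monoid" where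
  "weight_chain_group K \<epsilon> k n =
     free_Abelian_group {\<sigma> \<in> K. card \<sigma> = Suc n \<and> weight \<epsilon> \<sigma> = k}"

definition horizontal_cycles ::
    "'a set set \<Rightarrow> (nat \<Rightarrow> 'a) \<Rightarrow> ('a \<Rightarrow> nat) \<Rightarrow> nat \<Rightarrow> nat \<Rightarrow> ('a set \<Rightarrow>\<^sub>0 int) set" where
  "horizontal_cycles K v \<epsilon> k n =
     {c \<in> carrier (weight_chain_group K \<epsilon> k n). horizontal_boundary K v \<epsilon> c = 0}"

definition horizontal_boundaries ::
    "'a set set \<Rightarrow> (nat \<Rightarrow> 'a) \<Rightarrow> ('a \<Rightarrow> nat) \<Rightarrow> nat \<Rightarrow> nat \<Rightarrow> ('a set \<Rightarrow>\<^sub>0 int) set" where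
  "horizontal_boundaries K v \<epsilon> k n =
     horizontal_boundary K v \<epsilon> ` carrier (weight_chain_group K \<epsilon> k (Suc n))"

definition horizontal_homology ::
    "'a set set \<Rightarrow> (nat \<Rightarrow> 'a) \<Rightarrow> ('a \<Rightarrow> nat) \<Rightarrow> nat \<Rightarrow> nat \<Rightarrow> ('a set \<Rightarrow>\<^sub>0 int) set monoid" where
  "horizontal_homology K v \<epsilon> k n =
     (weight_chain_group K \<epsilon> k n)\<lparr>carrier := horizontal_cycles K v \<epsilon> k n\<rparr>
       Mod horizontal_boundaries K v \<epsilon> k n"

section \<open>Ueberhomology\<close>

definition edge_chain_map ::
    "(nat \<Rightarrow> 'a) \<Rightarrow> nat \<Rightarrow> ('a \<Rightarrow> nat) \<Rightarrow> ('a \<Rightarrow> nat) \<Rightarrow> ('a set \<Rightarrow>\<^sub>0 int) \<Rightarrow> ('a set \<Rightarrow>\<^sub>0 int)" where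
  "edge_chain_map v i \<epsilon> \<epsilon>' =
     frag_extend (\<lambda>\<sigma>. if weight \<epsilon> \<sigma> = weight \<epsilon>' \<sigma>
       then frag_cmul ((-1) ^ card {j \<in> {1..<i}. \<epsilon> (v j) = 1}) (frag_of \<sigma>) else 0)"

text \<open>
  The induced map on classes: the image of the coset \<open>A\<close> of \<open>c\<close> under the chain map, enlarged by
  the boundaries of the target, is the coset of the image of \<open>c\<close>.
\<close>

definition edge_map ::
    "'a set set \<Rightarrow> (nat \<Rightarrow> 'a) \<Rightarrow> nat \<Rightarrow> nat \<Rightarrow> nat \<Rightarrow> ('a \<Rightarrow> nat) \<Rightarrow> ('a \<Rightarrow> nat) \<Rightarrow>
      ('a set \<Rightarrow>\<^sub>0 int) set \<Rightarrow> ('a set \<Rightarrow>\<^sub>0 int) set" where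
  "edge_map K v k n i \<epsilon> \<epsilon>' A =
     horizontal_boundaries K v \<epsilon>' k n
       <#>\<^bsub>weight_chain_group K \<epsilon>' k n\<^esub> edge_chain_map v i \<epsilon> \<epsilon>' ` A"

definition uber_cochain_group ::
    "'a set set \<Rightarrow> (nat \<Rightarrow> 'a) \<Rightarrow> nat \<Rightarrow> nat \<Rightarrow> nat \<Rightarrow>
      (('a \<Rightarrow> nat) \<Rightarrow> ('a set \<Rightarrow>\<^sub>0 int) set) monoid" where
  "uber_cochain_group K v j k n =
     sum_group {\<epsilon> \<in> bicolourings K. colouring_length K \<epsilon> = j}
       (\<lambda>\<epsilon>. horizontal_homology K v \<epsilon> k n)"

text \<open>
  The component at \<open>\<epsilon>'\<close> collects the edges ending there; they start at the colourings obtained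
  from \<open>\<epsilon>'\<close> by changing one vertex \<open>v i\<close> of colour 1 to colour 0. The iterated product
  \<open>\<Otimes>\<close> is the sum in the abelian group of the component.
\<close>

definition uber_differential ::
    "'a set set \<Rightarrow> (nat \<Rightarrow> 'a) \<Rightarrow> nat \<Rightarrow> nat \<Rightarrow> nat \<Rightarrow>
      (('a \<Rightarrow> nat) \<Rightarrow> ('a set \<Rightarrow>\<^sub>0 int) set) \<Rightarrow> (('a \<Rightarrow> nat) \<Rightarrow> ('a set \<Rightarrow>\<^sub>0 int) set)" where
  "uber_differential K v j k n x =
     (\<lambda>\<epsilon>' \<in> {\<epsilon>' \<in> bicolourings K. colouring_length K \<epsilon>' = Suc j}.
        \<Otimes>\<^bsub>horizontal_homology K v \<epsilon>' k n\<^esub>i \<in> {i \<in> {1..card (vertex_set K)}. \<epsilon>' (v i) = 1}.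
          edge_map K v k n i (\<epsilon>'(v i := 0)) \<epsilon>' (x (\<epsilon>'(v i := 0))))"

definition uber_cocycles ::
    "'a set set \<Rightarrow> (nat \<Rightarrow> 'a) \<Rightarrow> nat \<Rightarrow> nat \<Rightarrow> nat \<Rightarrow>
      (('a \<Rightarrow> nat) \<Rightarrow> ('a set \<Rightarrow>\<^sub>0 int) set) set" where
  "uber_cocycles K v j k n =
     kernel (uber_cochain_group K v j k n) (uber_cochain_group K v (Suc j) k n)
       (uber_differential K v j k n)"

definition uber_coboundaries ::
    "'a set set \<Rightarrow> (nat \<Rightarrow> 'a) \<Rightarrow> nat \<Rightarrow> nat \<Rightarrow> nat \<Rightarrow>
      (('a \<Rightarrow> nat) \<Rightarrow> ('a set \<Rightarrow>\<^sub>0 int) set) set" where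
  "uber_coboundaries K v j k n =
     (case j of 0 \<Rightarrow> {\<one>\<^bsub>uber_cochain_group K v 0 k n\<^esub>}
      | Suc j' \<Rightarrow> uber_differential K v j' k n ` carrier (uber_cochain_group K v j' k n))"

definition uberhomology ::
    "'a set set \<Rightarrow> (nat \<Rightarrow> 'a) \<Rightarrow> nat \<Rightarrow> nat \<Rightarrow> nat \<Rightarrow>
      (('a \<Rightarrow> nat) \<Rightarrow> ('a set \<Rightarrow>\<^sub>0 int) set) set monoid" where
  "uberhomology K v j k n =
     (uber_cochain_group K v j k n)\<lparr>carrier := uber_cocycles K v j k n\<rparr>
       Mod uber_coboundaries K v j k n"

definition uberhomology0 ::
    "'a set set \<Rightarrow> (nat \<Rightarrow> 'a) \<Rightarrow> nat \<Rightarrow> nat \<Rightarrow>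
      (('a \<Rightarrow> nat) \<Rightarrow> ('a set \<Rightarrow>\<^sub>0 int) set) set monoid" where
  "uberhomology0 K v j n = uberhomology K v j 0 n"

end

(*
  A family of chains indexed by vertex subsets I carries two commuting differentials: the
  simplicial boundary, and the signed sum over the subsets I - {x}. Both are instances of one
  alternating sum over faces, whose square vanishes. If K is the full simplex, every nonempty
  K[I] is acyclic by coning off its first vertex, so only the augmentation row survives; this is
  the cochain complex of a cube truncated at the empty set, which is exact above degree 1 by
  adding the first vertex. If K is not full, let N be a nonface of minimal size r. For r = 2 the
  missing edge N forces all components of a degree 1 cocycle to vanish. For r > 2 the simplex
  boundaries of all r-subsets form a cocycle in degree r and dimension r - 2; it is nonzero at N,
  and the cochain group in degree r - 1 and dimension r - 2 vanishes since all sets of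
  size r - 1 are simplices.
*)
theory Submission
  imports Defs
begin

text \<open>The sign of the colouring differential counts the earlier vertices of I just as the
  boundary counts those of a simplex, so the diagonal family sending I to the generator I has the
  boundary of I as coboundary. Both nonzero classes come from it. On the single vertices of a full
  simplex it is a cocycle, since edges fill its coboundary; only a generator over the empty set
  could make it trivial, and homology vanishes there. For a minimal nonface with r > 2 the
  coboundary itself is the class: a single simplex of size r - 1 > 1 is not a cycle, so the diagonal
  family is no cochain one degree lower.

  This fails for r = 2: vertices are cycles because homology is unreduced, the family of boundaries
  of pairs is a coboundary, and a missing edge has to be detected by the vanishing of degree 1
  instead.

  The boundary is augmented although homology is not, because the homotopy identity for coning holds
  in dimension 0 only with the empty face as a generator.\<close>

section \<open>Alternating sums over faces\<close>

text \<open>With \<open>f = frag_of\<close> this is the augmented boundary of \<sigma>; with a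
  family of chains \<open>f\<close> it is the coboundary of that family at the vertex set
  \<sigma>.\<close>

definition face_sum :: "(nat \<Rightarrow> 'a) \<Rightarrow> nat \<Rightarrow> ('a set \<Rightarrow> ('b \<Rightarrow>\<^sub>0 int)) \<Rightarrow> 'a set \<Rightarrow> ('b \<Rightarrow>\<^sub>0 int)" where
  "face_sum v m f \<sigma> =
     (\<Sum>i | i \<in> {1..m} \<and> v i \<in> \<sigma>. frag_cmul ((-1) ^ card {j \<in> {1..<i}. v j \<in> \<sigma>}) (f (\<sigma> - {v i})))"

text \<open>Exchanging the two summations turns the sum into its own negative, and a free abelian
  group has no 2-torsion.\<close>

lemma sum_antisym_eq_0:
  fixes g :: "'i::linorder \<Rightarrow> 'i \<Rightarrow> ('b \<Rightarrow>\<^sub>0 int)"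
  assumes "finite A" and anti: "\<And>i k. i \<in> A \<Longrightarrow> k \<in> A \<Longrightarrow> i < k \<Longrightarrow> g k i = - g i k"
  shows "(\<Sum>i\<in>A. \<Sum>k\<in>A - {i}. g i k) = 0"
proof -
  \<comment> \<open>Filling the diagonal with 0 makes the index set a full square, where the
    exchange applies.\<close>
  define h where "h i k = (if i = k then 0 else g i k)" for i k
  have h: "h k i = - h i k" if "i \<in> A" "k \<in> A" for i k
    using anti[of i k] anti[of k i] that by (cases i k rule: linorder_cases) (auto simp: h_def)
  define S where "S = (\<Sum>i\<in>A. \<Sum>k\<in>A. h i k)"
  have "S = (\<Sum>i\<in>A. \<Sum>k\<in>A. h k i)"
    unfolding S_def by (rule sum.swap)
  also have "\<dots> = (\<Sum>i\<in>A. \<Sum>k\<in>A. - h i k)"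
    by (intro sum.cong refl h)
  also have "\<dots> = - S"
    by (simp add: S_def sum_negf)
  finally have S: "S = - S" .
  have "S = 0"
  proof (rule poly_mapping_eqI)
    fix x
    have "poly_mapping.lookup S x = - poly_mapping.lookup S x"
      using arg_cong[OF S, of "\<lambda>p. poly_mapping.lookup p x"] by (simp only: lookup_uminus)
    then show "poly_mapping.lookup S x = poly_mapping.lookup 0 x"
      by simp
  qed
  moreover have "(\<Sum>k\<in>A - {i}. g i k) = (\<Sum>k\<in>A. h i k)" if "i \<in> A" for i
  proof -
    have "(\<Sum>k\<in>A. h i k) = h i i + (\<Sum>k\<in>A - {i}. h i k)"
      using assms(1) that by (rule sum.remove)
    also have "\<dots> = (\<Sum>k\<in>A - {i}. g i k)"
      by (simp add: h_def) (rule sum.cong, auto)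
    finally show ?thesis ..
  qed
  ultimately show ?thesis
    unfolding S_def by simp
qed

text \<open>For i < k, deleting \<open>v i\<close> first lowers the sign exponent of
  \<open>v k\<close> by one, while deleting \<open>v k\<close> first leaves that of
  \<open>v i\<close> alone; the two orders cancel.\<close>

lemma face_sum_face_sum:
  assumes inj: "inj_on v {1..m}"
  shows "face_sum v m (face_sum v m f) \<sigma> = 0"
proof -
  have v_eq: "v i = v k \<longleftrightarrow> i = k" if "i \<in> {1..m}" "k \<in> {1..m}" for i k
    using inj that by (rule inj_on_eq_iff)
  let ?A = "{i. i \<in> {1..m} \<and> v i \<in> \<sigma>}"
  let ?p = "\<lambda>\<sigma> i. card {j \<in> {1..<i}. v j \<in> \<sigma>}"
  let ?g = "\<lambda>i k. frag_cmul ((-1) ^ (?p \<sigma> i + ?p (\<sigma> - {v i}) k)) (f (\<sigma> - {v i} - {v k}))"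
  have "face_sum v m (face_sum v m f) \<sigma> = (\<Sum>i\<in>?A. \<Sum>k\<in>?A - {i}. ?g i k)"
    unfolding face_sum_def
  proof (rule sum.cong[OF refl])
    fix i assume i: "i \<in> ?A"
    have "{k. k \<in> {1..m} \<and> v k \<in> \<sigma> - {v i}} = ?A - {i}"
      using i by (auto simp: v_eq)
    then show "frag_cmul ((-1) ^ ?p \<sigma> i)
        (\<Sum>k | k \<in> {1..m} \<and> v k \<in> \<sigma> - {v i}. frag_cmul ((-1) ^ ?p (\<sigma> - {v i}) k) (f (\<sigma> - {v i} - {v k})))
      = (\<Sum>k\<in>?A - {i}. ?g i k)"
      by (simp add: frag_cmul_sum power_add)
  qed
  also have "\<dots> = 0"
  proof (rule sum_antisym_eq_0)
    fix i k assume ik: "i \<in> ?A" "k \<in> ?A" "i < k"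
    have "{j \<in> {1..<k}. v j \<in> \<sigma>} = insert i {j \<in> {1..<k}. v j \<in> \<sigma> - {v i}}"
      using ik by (auto simp: v_eq)
    then have k: "?p \<sigma> k = Suc (?p (\<sigma> - {v i}) k)"
      by simp
    have i: "?p (\<sigma> - {v k}) i = ?p \<sigma> i"
    proof (rule arg_cong[where f = card])
      show "{j \<in> {1..<i}. v j \<in> \<sigma> - {v k}} = {j \<in> {1..<i}. v j \<in> \<sigma>}"
        using ik by (auto simp: v_eq)
    qed
    have "\<sigma> - {v k} - {v i} = \<sigma> - {v i} - {v k}"
      by blast
    then show "?g k i = - ?g i k"
      unfolding k i by (simp add: mult.commute power_add)
  qed simp
  finally show ?thesis .
qed

lemma face_sum_cong:
  assumes "\<And>i. i \<in> {1..m} \<Longrightarrow> v i \<in> \<sigma> \<Longrightarrow> f (\<sigma> - {v i}) = g (\<sigma> - {v i})"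
  shows "face_sum v m f \<sigma> = face_sum v m g \<sigma>"
  unfolding face_sum_def using assms by (auto intro: sum.cong)

lemma face_sum_add: "face_sum v m (\<lambda>\<tau>. f \<tau> + g \<tau>) \<sigma> = face_sum v m f \<sigma> + face_sum v m g \<sigma>"
  by (simp add: face_sum_def frag_cmul_distrib2 sum.distrib)

lemma frag_extend_face_sum:
  "frag_extend b (face_sum v m f \<sigma>) = face_sum v m (\<lambda>\<tau>. frag_extend b (f \<tau>)) \<sigma>"
  by (simp add: face_sum_def frag_extend_sum frag_extend_cmul o_def)

text \<open>Since \<open>v p\<close> precedes all of \<sigma>, its own term has sign +1 and it
  shifts every other exponent by one. Both contractions, coning for the boundary and adding
  \<open>v 1\<close> for the cube, are read off from this identity.\<close>

lemma face_sum_insert_first: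
  assumes inj: "inj_on v {1..m}" and p: "p \<in> {1..m}" "v p \<notin> \<sigma>" "\<And>i. i \<in> {1..<p} \<Longrightarrow> v i \<notin> \<sigma>"
  shows "face_sum v m f (insert (v p) \<sigma>) = f \<sigma> - face_sum v m (\<lambda>\<tau>. f (insert (v p) \<tau>)) \<sigma>"
proof -
  have v_eq: "v i = v p \<longleftrightarrow> i = p" if "i \<in> {1..m}" for i
    using inj that p(1) by (rule inj_on_eq_iff)
  let ?p = "\<lambda>\<sigma> i. card {j \<in> {1..<i}. v j \<in> \<sigma>}"
  let ?A = "{i. i \<in> {1..m} \<and> v i \<in> \<sigma>}"
  have A: "{i. i \<in> {1..m} \<and> v i \<in> insert (v p) \<sigma>} = insert p ?A"
    using p(1,2) by (auto simp: v_eq)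
  have p0: "{j \<in> {1..<p}. v j \<in> insert (v p) \<sigma>} = {}"
    using p(1,3) by (auto simp: v_eq)
  then have card_p0: "?p (insert (v p) \<sigma>) p = 0"
    by (simp only: card.empty)
  have *: "frag_cmul ((-1) ^ ?p (insert (v p) \<sigma>) i) (f (insert (v p) \<sigma> - {v i}))
      = - frag_cmul ((-1) ^ ?p \<sigma> i) (f (insert (v p) (\<sigma> - {v i})))" if i: "i \<in> ?A" for i
  proof -
    have "p < i"
    proof (rule ccontr)
      assume "\<not> p < i"
      moreover have "p \<noteq> i"
        using i p(2) by auto
      ultimately have "i \<in> {1..<p}"
        using i by auto
      then show False
        using p(3) i by blast
    qed
    then have "{j \<in> {1..<i}. v j \<in> insert (v p) \<sigma>} = insert p {j \<in> {1..<i}. v j \<in> \<sigma>}"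
      using p(1) i by (auto simp: v_eq)
    moreover have "insert (v p) \<sigma> - {v i} = insert (v p) (\<sigma> - {v i})"
      using i p by auto
    ultimately show ?thesis
      using p by simp
  qed
  have "face_sum v m f (insert (v p) \<sigma>) = f (insert (v p) \<sigma> - {v p})
      + (\<Sum>i\<in>?A. frag_cmul ((-1) ^ ?p (insert (v p) \<sigma>) i) (f (insert (v p) \<sigma> - {v i})))"
    unfolding face_sum_def A using p(2) by (subst sum.insert) (simp_all only: card_p0, simp_all)
  also have "insert (v p) \<sigma> - {v p} = \<sigma>"
    using p(2) by auto
  also have "(\<Sum>i\<in>?A. frag_cmul ((-1) ^ ?p (insert (v p) \<sigma>) i) (f (insert (v p) \<sigma> - {v i})))
      = (\<Sum>i\<in>?A. - frag_cmul ((-1) ^ ?p \<sigma> i) (f (insert (v p) (\<sigma> - {v i}))))"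
    by (rule sum.cong[OF refl]) (rule *)
  also have "\<dots> = - face_sum v m (\<lambda>\<tau>. f (insert (v p) \<tau>)) \<sigma>"
    unfolding face_sum_def by (rule sum_negf)
  finally show ?thesis
    by simp
qed

section \<open>Quotients of additive groups\<close>

text \<open>Subgroups are bare sets in a type class group, so chains are handled with
  \<open>+\<close> and \<open>-\<close> of the type instead of record operations.\<close>

definition additive_subgroup_of :: "'b::ab_group_add set \<Rightarrow> bool" where
  "additive_subgroup_of B \<longleftrightarrow> 0 \<in> B \<and> (\<forall>x\<in>B. \<forall>y\<in>B. x - y \<in> B)"

lemma additive_subgroup_ofD:
  assumes "additive_subgroup_of B"
  shows "0 \<in> B" "x \<in> B \<Longrightarrow> y \<in> B \<Longrightarrow> x - y \<in> B" "x \<in> B \<Longrightarrow> - x \<in> B" "x \<in> B \<Longrightarrow> y \<in> B \<Longrightarrow> x + y \<in> B"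
proof -
  show 0: "0 \<in> B" and diff: "x \<in> B \<Longrightarrow> y \<in> B \<Longrightarrow> x - y \<in> B" for x y
    using assms by (auto simp: additive_subgroup_of_def)
  show neg: "x \<in> B \<Longrightarrow> - x \<in> B" for x
    using diff[OF 0, of x] by simp
  show "x \<in> B \<Longrightarrow> y \<in> B \<Longrightarrow> x + y \<in> B"
    using diff[of x "- y"] neg[of y] by simp
qed

definition additive_group :: "'b::ab_group_add set \<Rightarrow> 'b monoid" where
  "additive_group Z = \<lparr>carrier = Z, monoid.mult = (+), one = 0\<rparr>"

lemma additive_group_simps [simp]:
  "carrier (additive_group Z) = Z" "x \<otimes>\<^bsub>additive_group Z\<^esub> y = x + y" "\<one>\<^bsub>additive_group Z\<^esub> = 0"
  by (simp_all add: additive_group_def)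

lemma comm_group_additive_group:
  assumes "additive_subgroup_of Z"
  shows "comm_group (additive_group Z)"
proof (rule comm_groupI)
  show "\<exists>y\<in>carrier (additive_group Z). y \<otimes>\<^bsub>additive_group Z\<^esub> x = \<one>\<^bsub>additive_group Z\<^esub>"
    if "x \<in> carrier (additive_group Z)" for x
    using that additive_subgroup_ofD(3)[OF assms] by (intro bexI[of _ "- x"]) auto
qed (use additive_subgroup_ofD[OF assms] in \<open>auto simp: ac_simps\<close>)

lemma subgroup_additive_group:
  assumes "additive_subgroup_of Z" "additive_subgroup_of B" "B \<subseteq> Z"
  shows "subgroup B (additive_group Z)"
proof -
  interpret comm_group "additive_group Z"
    using assms(1) by (rule comm_group_additive_group)
  have "inv\<^bsub>additive_group Z\<^esub> x = - x" if "x \<in> B" for x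
    using that assms(3) additive_subgroup_ofD(3)[OF assms(1)] by (intro inv_equality) auto
  then show ?thesis
    using additive_subgroup_ofD[OF assms(2)] assms(3) by (intro subgroupI) auto
qed

definition coset :: "'b::ab_group_add set \<Rightarrow> 'b \<Rightarrow> 'b set" where
  "coset B c = (\<lambda>b. b + c) ` B"

lemma coset_eq_iff:
  assumes "additive_subgroup_of B"
  shows "coset B a = coset B b \<longleftrightarrow> a - b \<in> B"
proof
  assume "coset B a = coset B b"
  moreover have "a \<in> coset B a"
    using additive_subgroup_ofD(1)[OF assms] by (force simp: coset_def)
  ultimately show "a - b \<in> B"
    by (auto simp: coset_def)
next
  have *: "coset B a \<subseteq> coset B b" if "a - b \<in> B" for a b
  proof
    fix x assume "x \<in> coset B a"
    then obtain y where "y \<in> B" "x = y + a"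
      by (auto simp: coset_def)
    then show "x \<in> coset B b"
      using additive_subgroup_ofD(4)[OF assms _ that, of y]
      by (auto simp: coset_def intro!: image_eqI[of _ _ "y + (a - b)"])
  qed
  assume "a - b \<in> B"
  then show "coset B a = coset B b"
    using *[of a b] *[of b a] additive_subgroup_ofD(3)[OF assms, of "a - b"] by auto
qed

lemma coset_0 [simp]: "coset B 0 = B"
  by (simp add: coset_def)

context
  fixes Z B :: "'b::ab_group_add set"
  assumes Z: "additive_subgroup_of Z" and B: "additive_subgroup_of B" and sub: "B \<subseteq> Z"
begin

lemma comm_group_additive_quotient: "comm_group (additive_group Z Mod B)"
  using comm_group.abelian_FactGroup[OF comm_group_additive_group[OF Z] subgroup_additive_group[OF Z B sub]] .

lemma carrier_additive_quotient: "carrier (additive_group Z Mod B) = coset B ` Z"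
  by (auto simp: carrier_FactGroup r_coset_def coset_def)

lemma mult_additive_quotient:
  "a \<in> Z \<Longrightarrow> b \<in> Z \<Longrightarrow> coset B a \<otimes>\<^bsub>additive_group Z Mod B\<^esub> coset B b = coset B (a + b)"
proof -
  interpret comm_group "additive_group Z"
    using Z by (rule comm_group_additive_group)
  interpret normal B "additive_group Z"
    using subgroup_additive_group[OF Z B sub] by (simp add: normal_iff_subgroup)
  assume "a \<in> Z" "b \<in> Z"
  then show ?thesis
    using rcos_sum[of a b] by (simp add: r_coset_def coset_def UNION_singleton_eq_range)
qed

text \<open>The differential is defined by a product in the quotient; this moves it to a sum of
  representatives. Membership of the sum in \<open>Z\<close> is proved along with it, because the
  product rule for cosets asks for it at each induction step.\<close>

lemma finprod_additive_quotient:
  assumes "finite A" "\<And>i. i \<in> A \<Longrightarrow> c i \<in> Z"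
  shows "finprod (additive_group Z Mod B) (\<lambda>i. coset B (c i)) A = coset B (\<Sum>i\<in>A. c i)"
    and "(\<Sum>i\<in>A. c i) \<in> Z"
proof -
  interpret Q: comm_group "additive_group Z Mod B"
    by (rule comm_group_additive_quotient)
  have "finprod (additive_group Z Mod B) (\<lambda>i. coset B (c i)) A = coset B (\<Sum>i\<in>A. c i) \<and> (\<Sum>i\<in>A. c i) \<in> Z"
    using assms
  proof (induction A rule: finite_induct)
    case empty
    then show ?case
      using additive_subgroup_ofD(1)[OF Z] by simp
  next
    case (insert i A)
    have IH: "finprod (additive_group Z Mod B) (\<lambda>i. coset B (c i)) A = coset B (\<Sum>i\<in>A. c i)"
        "(\<Sum>i\<in>A. c i) \<in> Z"
      using insert.IH insert.prems by blast+
    have "finprod (additive_group Z Mod B) (\<lambda>i. coset B (c i)) (insert i A)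
        = coset B (c i) \<otimes>\<^bsub>additive_group Z Mod B\<^esub> finprod (additive_group Z Mod B) (\<lambda>i. coset B (c i)) A"
      using insert.prems by (intro Q.finprod_insert insert.hyps) (auto simp: carrier_additive_quotient)
    also have "\<dots> = coset B (c i + (\<Sum>i\<in>A. c i))"
      unfolding IH(1) using insert.prems IH(2) by (intro mult_additive_quotient) auto
    finally show ?case
      using insert.hyps insert.prems IH(2) additive_subgroup_ofD(4)[OF Z, of "c i"] by simp
  qed
  then show "finprod (additive_group Z Mod B) (\<lambda>i. coset B (c i)) A = coset B (\<Sum>i\<in>A. c i)"
    and "(\<Sum>i\<in>A. c i) \<in> Z"
    by auto
qed

end

lemma frag_extend_frag_extend:
  "frag_extend f (frag_extend g c) = frag_extend (\<lambda>x. frag_extend f (g x)) c"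
  unfolding frag_extend_def[of g] frag_extend_def[of "\<lambda>x. frag_extend f (g x)"]
  by (simp add: frag_extend_sum frag_extend_cmul o_def)

lemma keys_face_sum:
  "Poly_Mapping.keys (face_sum v m f \<sigma>)
     \<subseteq> (\<Union>i\<in>{i \<in> {1..m}. v i \<in> \<sigma>}. Poly_Mapping.keys (f (\<sigma> - {v i})))"
proof -
  have "Poly_Mapping.keys (face_sum v m f \<sigma>) \<subseteq> (\<Union>i\<in>{i \<in> {1..m}. v i \<in> \<sigma>}.
      Poly_Mapping.keys (frag_cmul ((-1) ^ card {j \<in> {1..<i}. v j \<in> \<sigma>}) (f (\<sigma> - {v i}))))"
    unfolding face_sum_def by (rule Poly_Mapping.keys_sum)
  also have "\<dots> \<subseteq> (\<Union>i\<in>{i \<in> {1..m}. v i \<in> \<sigma>}. Poly_Mapping.keys (f (\<sigma> - {v i})))"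
    by (intro UN_mono keys_cmul order_refl)
  finally show ?thesis .
qed

section \<open>Weight 0 horizontal homology\<close>

definition ones :: "'a set set \<Rightarrow> ('a \<Rightarrow> nat) \<Rightarrow> 'a set" where
  "ones K \<epsilon> = {x \<in> vertex_set K. \<epsilon> x = 1}"

lemma bicolourings_cases:
  "\<epsilon> \<in> bicolourings K \<Longrightarrow> x \<in> vertex_set K \<Longrightarrow> \<epsilon> x = 0 \<or> \<epsilon> x = 1"
  by (auto simp: bicolourings_def PiE_iff)

locale ordered_complex =
  fixes K :: "'a set set" and v :: "nat \<Rightarrow> 'a" and m :: nat
  assumes complex: "finite_simplicial_complex K"
    and enum: "bij_betw v {1..m} (vertex_set K)"
begin

lemma inj_v: "inj_on v {1..m}"
  using enum by (rule bij_betw_imp_inj_on)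

lemma v_image: "v ` {1..m} = vertex_set K"
  using enum by (rule bij_betw_imp_surj_on)

lemma v_in [intro]: "i \<in> {1..m} \<Longrightarrow> v i \<in> vertex_set K"
  using v_image by blast

lemma card_vertex_set [simp]: "card (vertex_set K) = m"
  using bij_betw_same_card[OF enum] by simp

lemma finite_vertex_set [simp]: "finite (vertex_set K)"
  using v_image by (metis finite_atLeastAtMost finite_imageI)

lemma face_closed: "\<sigma> \<in> K \<Longrightarrow> \<tau> \<subseteq> \<sigma> \<Longrightarrow> \<tau> \<noteq> {} \<Longrightarrow> \<tau> \<in> K"
  using complex unfolding finite_simplicial_complex_def by blast

lemma simplex_subset: "\<sigma> \<in> K \<Longrightarrow> \<sigma> \<subseteq> vertex_set K"
  by (auto simp: vertex_set_def)

definition faces :: "'a set \<Rightarrow> nat \<Rightarrow> 'a set set" where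
  "faces I n = {\<sigma> \<in> K. card \<sigma> = Suc n \<and> \<sigma> \<subseteq> I}"

definition chains :: "'a set \<Rightarrow> nat \<Rightarrow> ('a set \<Rightarrow>\<^sub>0 int) set" where
  "chains I n = {c. Poly_Mapping.keys c \<subseteq> faces I n}"

text \<open>The augmented boundary, with the empty face as the generator in dimension \<open>-1\<close>.\<close>

definition red :: "('a set \<Rightarrow>\<^sub>0 int) \<Rightarrow> ('a set \<Rightarrow>\<^sub>0 int)" where
  "red = frag_extend (face_sum v m frag_of)"

text \<open>Homology is unreduced, so every chain of dimension 0 is a cycle; \<open>red\<close>
  would send a vertex to the empty face.\<close>

definition cycles :: "'a set \<Rightarrow> nat \<Rightarrow> ('a set \<Rightarrow>\<^sub>0 int) set" where
  "cycles I n = {c \<in> chains I n. n = 0 \<or> red c = 0}"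

definition boundaries :: "'a set \<Rightarrow> nat \<Rightarrow> ('a set \<Rightarrow>\<^sub>0 int) set" where
  "boundaries I n = red ` chains I (Suc n)"

lemma red_of [simp]: "red (frag_of \<sigma>) = face_sum v m frag_of \<sigma>"
  by (simp add: red_def)

lemma red_0 [simp]: "red 0 = 0"
  by (simp add: red_def)

lemma red_diff: "red (a - b) = red a - red b"
  by (simp add: red_def frag_extend_diff)

text \<open>\<open>red\<close> is linear and acts on each component, so it commutes with the
  coboundary without a sign.\<close>

lemma red_face_sum: "red (face_sum v m f \<sigma>) = face_sum v m (\<lambda>\<tau>. red (f \<tau>)) \<sigma>"
  by (simp add: red_def frag_extend_face_sum)

lemma red_red [simp]: "red (red c) = 0"
proof -
  have "red (red c) = frag_extend (\<lambda>\<sigma>. face_sum v m (face_sum v m frag_of) \<sigma>) c"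
    unfolding red_def by (simp add: frag_extend_frag_extend frag_extend_face_sum)
  then show ?thesis
    by (simp add: face_sum_face_sum[OF inj_v] frag_extend_eq_0)
qed

lemma additive_chains: "additive_subgroup_of (chains I n)"
  using keys_diff by (fastforce simp: additive_subgroup_of_def chains_def)

text \<open>Dimension at least 1 matters: the faces are then nonempty, hence simplices of
  \<open>K\<close>.\<close>

lemma red_chains:
  assumes c: "c \<in> chains I (Suc n)"
  shows "red c \<in> chains I n"
proof -
  have "Poly_Mapping.keys (red c) \<subseteq> (\<Union>\<sigma>\<in>Poly_Mapping.keys c. Poly_Mapping.keys (face_sum v m frag_of \<sigma>))"
    unfolding red_def by (rule keys_frag_extend)
  also have "\<dots> \<subseteq> faces I n"
  proof (rule UN_least)
    fix \<sigma> assume "\<sigma> \<in> Poly_Mapping.keys c"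
    then have \<sigma>: "\<sigma> \<in> K" "card \<sigma> = Suc (Suc n)" "\<sigma> \<subseteq> I"
      using c by (auto simp: chains_def faces_def)
    have "\<sigma> - {x} \<in> faces I n" if "x \<in> \<sigma>" for x
    proof -
      have card: "card (\<sigma> - {x}) = Suc n"
        using \<sigma>(2) that by (simp add: card_Diff_singleton)
      then have "\<sigma> - {x} \<noteq> {}"
        by (metis card.empty nat.distinct(1))
      then show ?thesis
        using \<sigma>(3) card face_closed[OF \<sigma>(1), of "\<sigma> - {x}"] by (auto simp: faces_def)
    qed
    then show "Poly_Mapping.keys (face_sum v m frag_of \<sigma>) \<subseteq> faces I n"
      by (intro order_trans[OF keys_face_sum] UN_least) simp
  qed
  finally show ?thesis
    by (simp add: chains_def)
qed

lemma additive_cycles: "additive_subgroup_of (cycles I n)"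
  using additive_chains[of I n] by (auto simp: additive_subgroup_of_def cycles_def red_diff)

lemma additive_boundaries: "additive_subgroup_of (boundaries I n)"
proof -
  have "0 \<in> boundaries I n"
    unfolding boundaries_def using additive_subgroup_ofD(1)[OF additive_chains] red_0 by (metis imageI)
  moreover have "x - y \<in> boundaries I n" if "x \<in> boundaries I n" "y \<in> boundaries I n" for x y
    using that additive_subgroup_ofD(2)[OF additive_chains]
    unfolding boundaries_def by (auto simp: red_diff[symmetric])
  ultimately show ?thesis
    by (auto simp: additive_subgroup_of_def)
qed

lemma boundaries_subset_cycles: "boundaries I n \<subseteq> cycles I n"
  by (auto simp: boundaries_def cycles_def red_chains)

lemmas homology_simps = additive_cycles additive_boundaries boundaries_subset_cycles

abbreviation homology :: "'a set \<Rightarrow> nat \<Rightarrow> ('a set \<Rightarrow>\<^sub>0 int) set monoid" where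
  "homology I n \<equiv> additive_group (cycles I n) Mod boundaries I n"

section \<open>Weight 0 as the homology of induced subcomplexes\<close>

lemma weight_eq_0_iff:
  assumes "\<epsilon> \<in> bicolourings K" "\<sigma> \<subseteq> vertex_set K"
  shows "weight \<epsilon> \<sigma> = 0 \<longleftrightarrow> \<sigma> \<subseteq> ones K \<epsilon>"
proof -
  have "finite \<sigma>"
    using assms(2) finite_vertex_set by (rule finite_subset)
  then have "weight \<epsilon> \<sigma> = 0 \<longleftrightarrow> (\<forall>x\<in>\<sigma>. \<epsilon> x \<noteq> 0)"
    by (auto simp: weight_def)
  also have "\<dots> \<longleftrightarrow> \<sigma> \<subseteq> ones K \<epsilon>"
    using assms(2) bicolourings_cases[OF assms(1)] by (fastforce simp: ones_def)
  finally show ?thesis .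
qed

lemma weight_chain_group_eq:
  assumes "\<epsilon> \<in> bicolourings K"
  shows "weight_chain_group K \<epsilon> 0 n = additive_group (chains (ones K \<epsilon>) n)"
proof -
  have "{\<sigma> \<in> K. card \<sigma> = Suc n \<and> weight \<epsilon> \<sigma> = 0} = faces (ones K \<epsilon>) n"
    using weight_eq_0_iff[OF assms simplex_subset] by (auto simp: faces_def)
  then show ?thesis
    by (simp add: weight_chain_group_def free_Abelian_group_def additive_group_def chains_def)
qed

lemma simplicial_boundary_of:
  "simplicial_boundary K v (frag_of \<sigma>) = face_sum v m (\<lambda>\<tau>. if \<tau> = {} then 0 else frag_of \<tau>) \<sigma>"
proof -
  let ?s = "\<lambda>i. (-1) ^ card {j \<in> {1..<i}. v j \<in> \<sigma>}"
  have "(\<Sum>i | i \<in> {1..m} \<and> v i \<in> \<sigma> \<and> \<sigma> - {v i} \<noteq> {}. frag_cmul (?s i) (frag_of (\<sigma> - {v i})))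
      = (\<Sum>i | i \<in> {1..m} \<and> v i \<in> \<sigma>. frag_cmul (?s i) (if \<sigma> - {v i} = {} then 0 else frag_of (\<sigma> - {v i})))"
    by (rule sum.mono_neutral_cong_left) auto
  then show ?thesis
    by (simp add: simplicial_boundary_def face_sum_def)
qed

text \<open>Faces of a weight 0 simplex have weight 0, so the weight filter removes nothing. Only
  the omission of the empty face is left, and it occurs exactly for n = 0.\<close>

lemma horizontal_boundary_eq:
  assumes \<epsilon>: "\<epsilon> \<in> bicolourings K" and c: "c \<in> chains (ones K \<epsilon>) n"
  shows "horizontal_boundary K v \<epsilon> c = (if n = 0 then 0 else red c)"
proof -
  have *: "frag_extend (\<lambda>\<tau>. if weight \<epsilon> \<tau> = weight \<epsilon> \<sigma> then frag_of \<tau> else 0)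
      (simplicial_boundary K v (frag_of \<sigma>)) = (if n = 0 then 0 else face_sum v m frag_of \<sigma>)"
    if "\<sigma> \<in> Poly_Mapping.keys c" for \<sigma>
  proof -
    have \<sigma>: "\<sigma> \<in> K" "card \<sigma> = Suc n" "\<sigma> \<subseteq> ones K \<epsilon>"
      using c that by (auto simp: chains_def faces_def)
    have w: "weight \<epsilon> \<tau> = 0" if "\<tau> \<subseteq> \<sigma>" for \<tau>
      using weight_eq_0_iff[OF \<epsilon>, of \<tau>] that \<sigma> simplex_subset by blast
    have ne: "(\<sigma> - {v i} = {}) = (n = 0)" if "v i \<in> \<sigma>" for i
    proof -
      have "card (\<sigma> - {v i}) = n"
        using \<sigma>(2) that by (simp add: card_Diff_singleton)
      moreover have "finite (\<sigma> - {v i})"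
        using \<sigma>(2) by (auto intro: card_ge_0_finite)
      ultimately show ?thesis
        by (metis card_eq_0_iff)
    qed
    have "frag_extend (\<lambda>\<tau>. if weight \<epsilon> \<tau> = weight \<epsilon> \<sigma> then frag_of \<tau> else 0)
        (simplicial_boundary K v (frag_of \<sigma>)) = face_sum v m (\<lambda>\<tau>. if n = 0 then 0 else frag_of \<tau>) \<sigma>"
      unfolding simplicial_boundary_of frag_extend_face_sum
      by (rule face_sum_cong) (use w ne in auto)
    then show ?thesis
      by (simp add: face_sum_def)
  qed
  have "horizontal_boundary K v \<epsilon> c
      = frag_extend (\<lambda>\<sigma>. if n = 0 then 0 else face_sum v m frag_of \<sigma>) c"
    unfolding horizontal_boundary_def by (rule frag_extend_eq) (rule *)
  then show ?thesis
    by (simp add: red_def frag_extend_eq_0)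
qed

lemma horizontal_cycles_eq:
  assumes "\<epsilon> \<in> bicolourings K"
  shows "horizontal_cycles K v \<epsilon> 0 n = cycles (ones K \<epsilon>) n"
  using horizontal_boundary_eq[OF assms, of _ n]
  by (auto simp: horizontal_cycles_def cycles_def weight_chain_group_eq[OF assms] split: if_splits)

lemma horizontal_boundaries_eq:
  assumes "\<epsilon> \<in> bicolourings K"
  shows "horizontal_boundaries K v \<epsilon> 0 n = boundaries (ones K \<epsilon>) n"
  using horizontal_boundary_eq[OF assms, of _ "Suc n"]
  by (auto simp: horizontal_boundaries_def boundaries_def weight_chain_group_eq[OF assms])

lemma horizontal_homology_eq:
  assumes "\<epsilon> \<in> bicolourings K"
  shows "horizontal_homology K v \<epsilon> 0 n = homology (ones K \<epsilon>) n"
  unfolding horizontal_homology_def weight_chain_group_eq[OF assms]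
    horizontal_cycles_eq[OF assms] horizontal_boundaries_eq[OF assms]
  by (simp add: additive_group_def)

end

section \<open>Cochains as families of cycles\<close>

lemma frag_extend_frag_cmul: "frag_extend (\<lambda>\<sigma>. frag_cmul s (frag_of \<sigma>)) a = frag_cmul s a"
proof -
  have "frag_extend (\<lambda>\<sigma>. frag_cmul s (frag_of \<sigma>)) a = frag_cmul s (frag_extend frag_of a)"
    by (simp add: frag_extend_def frag_cmul_sum mult.commute o_def)
  then show ?thesis
    by (simp add: frag_expansion[symmetric])
qed

lemma additive_subgroup_of_sign:
  assumes "additive_subgroup_of (B :: ('b \<Rightarrow>\<^sub>0 int) set)" "x \<in> B"
  shows "frag_cmul ((-1) ^ k) x \<in> B"
  using assms additive_subgroup_ofD(3)[OF assms] by (cases "even k") auto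

context ordered_complex
begin

definition colourings :: "nat \<Rightarrow> ('a \<Rightarrow> nat) set" where
  "colourings j = {\<epsilon> \<in> bicolourings K. colouring_length K \<epsilon> = j}"

text \<open>Undefined off the vertex set because \<open>bicolourings\<close> is an extensional
  function space; on subsets of the vertex set this makes it inverse to
  \<open>ones K\<close>.\<close>

definition colouring_of :: "'a set \<Rightarrow> 'a \<Rightarrow> nat" where
  "colouring_of I = (\<lambda>x\<in>vertex_set K. if x \<in> I then 1 else 0)"

lemma ones_subset: "ones K \<epsilon> \<subseteq> vertex_set K"
  by (auto simp: ones_def)

lemma ones_colouring_of [simp]: "I \<subseteq> vertex_set K \<Longrightarrow> ones K (colouring_of I) = I"
  by (auto simp: ones_def colouring_of_def split: if_splits)

lemma colouring_of_ones [simp]: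
  assumes "\<epsilon> \<in> bicolourings K"
  shows "colouring_of (ones K \<epsilon>) = \<epsilon>"
proof
  fix x
  show "colouring_of (ones K \<epsilon>) x = \<epsilon> x"
    using assms bicolourings_cases[OF assms, of x]
    by (auto simp: colouring_of_def ones_def bicolourings_def PiE_iff extensional_def)
qed

lemma colouring_length_eq:
  assumes "\<epsilon> \<in> bicolourings K"
  shows "colouring_length K \<epsilon> = card (ones K \<epsilon>)"
proof -
  have "\<epsilon> x = (if \<epsilon> x = 1 then 1 else 0)" if "x \<in> vertex_set K" for x
    using bicolourings_cases[OF assms that] by auto
  then have "colouring_length K \<epsilon> = (\<Sum>x\<in>vertex_set K. if \<epsilon> x = 1 then 1 else 0)"
    unfolding colouring_length_def by (rule sum.cong[OF refl])
  also have "\<dots> = card (ones K \<epsilon>)"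
    by (simp add: ones_def sum.If_cases Int_def)
  finally show ?thesis .
qed

lemma colouring_of_in: "I \<subseteq> vertex_set K \<Longrightarrow> colouring_of I \<in> bicolourings K"
  by (auto simp: colouring_of_def bicolourings_def)

lemma colouring_of_in_colourings:
  "I \<subseteq> vertex_set K \<Longrightarrow> card I = j \<Longrightarrow> colouring_of I \<in> colourings j"
  by (simp add: colourings_def colouring_length_eq colouring_of_in)

lemma colouringsD:
  "\<epsilon> \<in> colourings j \<Longrightarrow> \<epsilon> \<in> bicolourings K" "\<epsilon> \<in> colourings j \<Longrightarrow> card (ones K \<epsilon>) = j"
  by (auto simp: colourings_def colouring_length_eq)

lemma finite_colourings: "finite (colourings j)"
proof -
  have "finite (bicolourings K)"
    unfolding bicolourings_def by (intro finite_PiE) auto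
  then show ?thesis
    by (simp add: colourings_def)
qed

text \<open>Values at sets of other sizes are free, which lets one formula on all sets, such as
  \<open>frag_of\<close> or \<open>face_sum v m c\<close>, represent a cochain.\<close>

definition families :: "nat \<Rightarrow> nat \<Rightarrow> ('a set \<Rightarrow> ('a set \<Rightarrow>\<^sub>0 int)) set" where
  "families j n = {c. \<forall>I\<subseteq>vertex_set K. card I = j \<longrightarrow> c I \<in> cycles I n}"

definition cochain :: "nat \<Rightarrow> nat \<Rightarrow> ('a set \<Rightarrow> ('a set \<Rightarrow>\<^sub>0 int)) \<Rightarrow> ('a \<Rightarrow> nat) \<Rightarrow> ('a set \<Rightarrow>\<^sub>0 int) set" where
  "cochain j n c = (\<lambda>\<epsilon>\<in>colourings j. coset (boundaries (ones K \<epsilon>) n) (c (ones K \<epsilon>)))"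

lemma familiesD: "c \<in> families j n \<Longrightarrow> I \<subseteq> vertex_set K \<Longrightarrow> card I = j \<Longrightarrow> c I \<in> cycles I n"
  by (simp add: families_def)

lemma families_colouringsD: "c \<in> families j n \<Longrightarrow> \<epsilon> \<in> colourings j \<Longrightarrow> c (ones K \<epsilon>) \<in> cycles (ones K \<epsilon>) n"
  by (simp add: familiesD ones_subset colouringsD)

text \<open>Lets all later arguments work with representing cycles instead of cosets.\<close>

lemma cochain_eq_iff:
  "cochain j n c = cochain j n c' \<longleftrightarrow>
     (\<forall>I\<subseteq>vertex_set K. card I = j \<longrightarrow> c I - c' I \<in> boundaries I n)"
proof
  assume eq: "cochain j n c = cochain j n c'"
  show "\<forall>I\<subseteq>vertex_set K. card I = j \<longrightarrow> c I - c' I \<in> boundaries I n"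
  proof (intro allI impI)
    fix I assume I: "I \<subseteq> vertex_set K" "card I = j"
    then show "c I - c' I \<in> boundaries I n"
      using fun_cong[OF eq, of "colouring_of I"] coset_eq_iff[OF additive_boundaries]
      by (simp add: cochain_def colouring_of_in_colourings)
  qed
next
  assume "\<forall>I\<subseteq>vertex_set K. card I = j \<longrightarrow> c I - c' I \<in> boundaries I n"
  then show "cochain j n c = cochain j n c'"
    unfolding cochain_def
    by (intro restrict_ext) (simp add: coset_eq_iff[OF additive_boundaries] ones_subset colouringsD)
qed

lemma comm_group_homology: "comm_group (homology I n)"
  by (intro comm_group_additive_quotient homology_simps)

lemma uber_cochain_group_eq:
  "uber_cochain_group K v j 0 n = sum_group (colourings j) (\<lambda>\<epsilon>. horizontal_homology K v \<epsilon> 0 n)"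
  by (simp add: uber_cochain_group_def colourings_def)

lemma group_horizontal_homology:
  "\<epsilon> \<in> colourings j \<Longrightarrow> group (horizontal_homology K v \<epsilon> 0 n)"
  using comm_group_homology by (auto simp: horizontal_homology_eq colouringsD comm_group_def)

lemma group_uber_cochain_group: "group (uber_cochain_group K v j 0 n)"
  unfolding uber_cochain_group_eq by (intro sum_group group_horizontal_homology)

lemma carrier_uber_cochain_group:
  "carrier (uber_cochain_group K v j 0 n) = cochain j n ` families j n"
proof -
  have carrier: "carrier (uber_cochain_group K v j 0 n)
      = (\<Pi>\<^sub>E \<epsilon>\<in>colourings j. coset (boundaries (ones K \<epsilon>) n) ` cycles (ones K \<epsilon>) n)"
  proof -
    have "carrier (uber_cochain_group K v j 0 n) = (\<Pi>\<^sub>E \<epsilon>\<in>colourings j. carrier (horizontal_homology K v \<epsilon> 0 n))"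
      unfolding uber_cochain_group_eq
      \<comment> \<open>With finitely many colourings the direct sum is the full product.\<close>
      by (subst carrier_sum_group) (simp_all add: group_horizontal_homology finite_colourings)
    also have "\<dots> = (\<Pi>\<^sub>E \<epsilon>\<in>colourings j. coset (boundaries (ones K \<epsilon>) n) ` cycles (ones K \<epsilon>) n)"
      by (intro PiE_cong) (simp add: horizontal_homology_eq colouringsD carrier_additive_quotient[OF homology_simps])
    finally show ?thesis .
  qed
  show ?thesis
  proof (intro equalityI subsetI)
    fix x assume x: "x \<in> carrier (uber_cochain_group K v j 0 n)"
    \<comment> \<open>A cycle is chosen in each class; the choice is meaningful only at vertex sets
      of size \<open>j\<close>.\<close>
    define c where "c I = (SOME z. z \<in> cycles I n \<and> x (colouring_of I) = coset (boundaries I n) z)" for I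
    have c: "c I \<in> cycles I n \<and> x (colouring_of I) = coset (boundaries I n) (c I)"
      if "I \<subseteq> vertex_set K" "card I = j" for I
    proof -
      have "x (colouring_of I) \<in> coset (boundaries I n) ` cycles I n"
        using x colouring_of_in_colourings[OF that] that unfolding carrier by (fastforce simp: PiE_iff)
      then have "\<exists>z. z \<in> cycles I n \<and> x (colouring_of I) = coset (boundaries I n) z"
        by blast
      from someI_ex[OF this] show ?thesis
        unfolding c_def .
    qed
    have "x = cochain j n c"
    proof
      fix \<epsilon>
      show "x \<epsilon> = cochain j n c \<epsilon>"
      proof (cases "\<epsilon> \<in> colourings j")
        case True
        then show ?thesis
          using c[of "ones K \<epsilon>"] by (simp add: cochain_def ones_subset colouringsD)
      next
        case False
        then show ?thesis
          using x unfolding carrier by (auto simp: cochain_def PiE_iff extensional_def)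
      qed
    qed
    moreover have "c \<in> families j n"
      using c by (simp add: families_def)
    ultimately show "x \<in> cochain j n ` families j n"
      by blast
  next
    fix x assume "x \<in> cochain j n ` families j n"
    then show "x \<in> carrier (uber_cochain_group K v j 0 n)"
      unfolding carrier by (auto simp: cochain_def families_colouringsD)
  qed
qed

lemma one_uber_cochain_group: "\<one>\<^bsub>uber_cochain_group K v j 0 n\<^esub> = cochain j n (\<lambda>_. 0)"
  unfolding uber_cochain_group_eq one_sum_group cochain_def
  by (intro restrict_ext) (simp add: horizontal_homology_eq colouringsD)

lemma families_add: "c \<in> families j n \<Longrightarrow> c' \<in> families j n \<Longrightarrow> (\<lambda>I. c I + c' I) \<in> families j n"
  by (simp add: families_def additive_subgroup_ofD(4)[OF additive_cycles])

lemma families_0: "(\<lambda>_. 0) \<in> families j n"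
  by (simp add: families_def additive_subgroup_ofD(1)[OF additive_cycles])

lemma mult_uber_cochain_group:
  assumes "c \<in> families j n" "c' \<in> families j n"
  shows "cochain j n c \<otimes>\<^bsub>uber_cochain_group K v j 0 n\<^esub> cochain j n c' = cochain j n (\<lambda>I. c I + c' I)"
  unfolding uber_cochain_group_eq mult_sum_group cochain_def
proof (intro restrict_ext)
  fix \<epsilon> assume \<epsilon>: "\<epsilon> \<in> colourings j"
  show "(\<lambda>\<epsilon>\<in>colourings j. coset (boundaries (ones K \<epsilon>) n) (c (ones K \<epsilon>))) \<epsilon>
      \<otimes>\<^bsub>horizontal_homology K v \<epsilon> 0 n\<^esub>
      (\<lambda>\<epsilon>\<in>colourings j. coset (boundaries (ones K \<epsilon>) n) (c' (ones K \<epsilon>))) \<epsilon>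
    = coset (boundaries (ones K \<epsilon>) n) (c (ones K \<epsilon>) + c' (ones K \<epsilon>))"
    using \<epsilon> mult_additive_quotient[OF homology_simps families_colouringsD[OF assms(1) \<epsilon>] families_colouringsD[OF assms(2) \<epsilon>]]
    by (simp add: horizontal_homology_eq colouringsD del: mult_FactGroup)
qed

lemma comm_group_uber_cochain_group: "comm_group (uber_cochain_group K v j 0 n)"
proof (rule group.group_comm_groupI[OF group_uber_cochain_group])
  fix x y assume "x \<in> carrier (uber_cochain_group K v j 0 n)" "y \<in> carrier (uber_cochain_group K v j 0 n)"
  then show "x \<otimes>\<^bsub>uber_cochain_group K v j 0 n\<^esub> y = y \<otimes>\<^bsub>uber_cochain_group K v j 0 n\<^esub> x"
    by (auto simp: carrier_uber_cochain_group mult_uber_cochain_group add.commute)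
qed

lemma chains_mono: "I \<subseteq> J \<Longrightarrow> chains I n \<subseteq> chains J n"
  by (auto simp: chains_def faces_def)

lemma cycles_mono: "I \<subseteq> J \<Longrightarrow> cycles I n \<subseteq> cycles J n"
  using chains_mono[of I J n] by (auto simp: cycles_def)

lemma boundaries_mono: "I \<subseteq> J \<Longrightarrow> boundaries I n \<subseteq> boundaries J n"
  unfolding boundaries_def by (intro image_mono chains_mono)

text \<open>Vertices of colour 1 keep it, so a chain of weight 0 has weight 0 for both colourings
  and the map discards no simplex: it is the signed inclusion.\<close>

lemma edge_chain_map_eq:
  assumes "\<epsilon> \<in> bicolourings K" "\<epsilon>' \<in> bicolourings K" "ones K \<epsilon> \<subseteq> ones K \<epsilon>'"
    and a: "a \<in> chains (ones K \<epsilon>) n"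
  shows "edge_chain_map v i \<epsilon> \<epsilon>' a = frag_cmul ((-1) ^ card {j \<in> {1..<i}. \<epsilon> (v j) = 1}) a"
proof -
  have "weight \<epsilon> \<sigma> = weight \<epsilon>' \<sigma>" if "\<sigma> \<in> Poly_Mapping.keys a" for \<sigma>
  proof -
    have "\<sigma> \<subseteq> ones K \<epsilon>"
      using a that by (auto simp: chains_def faces_def)
    then show ?thesis
      using weight_eq_0_iff[OF assms(1), of \<sigma>] weight_eq_0_iff[OF assms(2), of \<sigma>] assms(3) ones_subset
      by (metis subset_trans)
  qed
  then have "edge_chain_map v i \<epsilon> \<epsilon>' a
      = frag_extend (\<lambda>\<sigma>. frag_cmul ((-1) ^ card {j \<in> {1..<i}. \<epsilon> (v j) = 1}) (frag_of \<sigma>)) a"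
    unfolding edge_chain_map_def by (intro frag_extend_eq) simp
  then show ?thesis
    by (simp only: frag_extend_frag_cmul)
qed

lemma ones_update: "ones K (\<epsilon>(x := 0)) = ones K \<epsilon> - {x}"
  by (auto simp: ones_def)

lemma bicolourings_update: "\<epsilon> \<in> bicolourings K \<Longrightarrow> x \<in> vertex_set K \<Longrightarrow> \<epsilon>(x := 0) \<in> bicolourings K"
  by (auto simp: bicolourings_def PiE_iff extensional_def)

text \<open>The target boundaries absorb the images of the source boundaries, so a coset goes to the
  coset of its signed representative.\<close>

lemma edge_map_eq:
  assumes \<epsilon>': "\<epsilon>' \<in> bicolourings K" and i: "i \<in> {1..m}"
    and z: "z \<in> cycles (ones K \<epsilon>' - {v i}) n"
  shows "edge_map K v 0 n i (\<epsilon>'(v i := 0)) \<epsilon>' (coset (boundaries (ones K \<epsilon>' - {v i}) n) z)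
     = coset (boundaries (ones K \<epsilon>') n)
         (frag_cmul ((-1) ^ card {j \<in> {1..<i}. v j \<in> ones K \<epsilon>'}) z)"
proof -
  let ?I = "ones K \<epsilon>' - {v i}" and ?s = "(-1) ^ card {j \<in> {1..<i}. v j \<in> ones K \<epsilon>'} :: int"
  let ?\<epsilon> = "\<epsilon>'(v i := 0)"
  have \<epsilon>: "?\<epsilon> \<in> bicolourings K"
    using \<epsilon>' i by (intro bicolourings_update v_in)
  have B: "boundaries ?I n \<subseteq> chains ?I n" "boundaries ?I n \<subseteq> boundaries (ones K \<epsilon>') n"
    using boundaries_subset_cycles boundaries_mono[of ?I "ones K \<epsilon>'" n] by (auto simp: cycles_def)
  \<comment> \<open>The colourings differ only at \<open>v i\<close>, and the index i lies outside
    \<open>{1..<i}\<close>, so the sign can be read off from the target.\<close>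
  have sgn: "{j \<in> {1..<i}. ?\<epsilon> (v j) = 1} = {j \<in> {1..<i}. v j \<in> ones K \<epsilon>'}"
  proof (rule Collect_cong, rule conj_cong[OF refl])
    fix j assume "j \<in> {1..<i}"
    then have "v j \<noteq> v i" "v j \<in> vertex_set K"
      using i inj_on_eq_iff[OF inj_v, of j i] by auto
    then show "(?\<epsilon> (v j) = 1) = (v j \<in> ones K \<epsilon>')"
      by (simp add: ones_def)
  qed
  have e: "edge_chain_map v i ?\<epsilon> \<epsilon>' (b + z) = frag_cmul ?s b + frag_cmul ?s z" if "b \<in> boundaries ?I n" for b
  proof -
    have "b + z \<in> chains ?I n"
      using that z B(1) additive_subgroup_ofD(4)[OF additive_chains] by (auto simp: cycles_def)
    then show ?thesis
      using edge_chain_map_eq[OF \<epsilon> \<epsilon>', of "b + z" n i] unfolding sgn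
      by (simp add: ones_update frag_cmul_distrib2 Diff_subset)
  qed
  have sb: "frag_cmul ?s b \<in> boundaries (ones K \<epsilon>') n" if "b \<in> boundaries ?I n" for b
    using that B(2) additive_subgroup_of_sign[OF additive_boundaries] by blast
  have "edge_map K v 0 n i ?\<epsilon> \<epsilon>' (coset (boundaries ?I n) z)
      = {b' + (frag_cmul ?s b + frag_cmul ?s z) | b' b. b' \<in> boundaries (ones K \<epsilon>') n \<and> b \<in> boundaries ?I n}"
    unfolding edge_map_def horizontal_boundaries_eq[OF \<epsilon>'] weight_chain_group_eq[OF \<epsilon>'] coset_def set_mult_def
    by (auto simp: e image_image)
  also have "\<dots> = coset (boundaries (ones K \<epsilon>') n) (frag_cmul ?s z)"
  proof (intro equalityI subsetI)
    fix x assume "x \<in> {b' + (frag_cmul ?s b + frag_cmul ?s z) | b' b. b' \<in> boundaries (ones K \<epsilon>') n \<and> b \<in> boundaries ?I n}"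
    then obtain b' b where "x = b' + (frag_cmul ?s b + frag_cmul ?s z)" "b' \<in> boundaries (ones K \<epsilon>') n" "b \<in> boundaries ?I n"
      by blast
    then show "x \<in> coset (boundaries (ones K \<epsilon>') n) (frag_cmul ?s z)"
      unfolding coset_def using sb additive_subgroup_ofD(4)[OF additive_boundaries]
      by (intro image_eqI[of _ _ "b' + frag_cmul ?s b"]) (auto simp: add.assoc)
  next
    fix x assume "x \<in> coset (boundaries (ones K \<epsilon>') n) (frag_cmul ?s z)"
    then obtain b' where "x = b' + (frag_cmul ?s 0 + frag_cmul ?s z)" "b' \<in> boundaries (ones K \<epsilon>') n"
      by (auto simp: coset_def)
    then show "x \<in> {b' + (frag_cmul ?s b + frag_cmul ?s z) | b' b. b' \<in> boundaries (ones K \<epsilon>') n \<and> b \<in> boundaries ?I n}"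
      using additive_subgroup_ofD(1)[OF additive_boundaries] by blast
  qed
  finally show ?thesis .
qed

end

section \<open>A criterion for exactness\<close>

lemma (in comm_group) trivial_group_quotient_iff:
  assumes Z: "subgroup Z G" and B: "subgroup B G" and sub: "B \<subseteq> Z"
  shows "trivial_group (G\<lparr>carrier := Z\<rparr> Mod B) \<longleftrightarrow> Z \<subseteq> B"
proof -
  interpret Z: comm_group "G\<lparr>carrier := Z\<rparr>"
  proof (rule group.group_comm_groupI)
    show "group (G\<lparr>carrier := Z\<rparr>)"
      using Z by (rule subgroup_imp_group)
  qed (use subgroup.subset[OF Z] in \<open>auto intro: m_comm\<close>)
  have B': "subgroup B (G\<lparr>carrier := Z\<rparr>)"
    using B Z sub by (rule subgroup_incl)
  interpret Q: comm_group "G\<lparr>carrier := Z\<rparr> Mod B"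
    using Z.abelian_FactGroup[OF B'] .
  have "trivial_group (G\<lparr>carrier := Z\<rparr> Mod B) \<longleftrightarrow> (\<lambda>x. B #>\<^bsub>G\<lparr>carrier := Z\<rparr>\<^esub> x) ` Z \<subseteq> {B}"
    by (simp add: Q.trivial_group_subset carrier_FactGroup)
  also have "\<dots> \<longleftrightarrow> Z \<subseteq> B"
    using Z.coset_join1[OF _ _ B'] Z.coset_join2[OF _ B'] sub by auto
  finally show ?thesis .
qed

context ordered_complex
begin

lemma face_sum_families:
  assumes "c \<in> families j n"
  shows "face_sum v m c \<in> families (Suc j) n"
  unfolding families_def
proof (intro CollectI allI impI)
  fix I assume I: "I \<subseteq> vertex_set K" "card I = Suc j"
  show "face_sum v m c I \<in> cycles I n"
    unfolding face_sum_def
  \<comment> \<open>The rule serves as closure of cycles under finite sums. Each summand is a cycle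
    over the smaller set \<open>I - {v i}\<close>, hence over \<open>I\<close>.\<close>
  proof (rule finprod_additive_quotient(2)[OF homology_simps])
    fix i assume "i \<in> {i. i \<in> {1..m} \<and> v i \<in> I}"
    then have "c (I - {v i}) \<in> cycles (I - {v i}) n"
      using I by (intro familiesD[OF assms]) (auto simp: card_Diff_singleton)
    then show "frag_cmul ((-1) ^ card {j \<in> {1..<i}. v j \<in> I}) (c (I - {v i})) \<in> cycles I n"
      using cycles_mono[of "I - {v i}" I n] additive_subgroup_of_sign[OF additive_cycles] by blast
  qed simp
qed

text \<open>Every incoming edge acts on representatives by a sign (\<open>edge_map_eq\<close>), and
  the product of the cosets is the coset of the sum; the signs are those of
  \<open>face_sum\<close>.\<close>

lemma uber_differential_cochain:
  assumes c: "c \<in> families j n"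
  shows "uber_differential K v j 0 n (cochain j n c) = cochain (Suc j) n (face_sum v m c)"
proof -
  have "(\<Otimes>\<^bsub>horizontal_homology K v \<epsilon>' 0 n\<^esub>i \<in> {i \<in> {1..card (vertex_set K)}. \<epsilon>' (v i) = 1}.
          edge_map K v 0 n i (\<epsilon>'(v i := 0)) \<epsilon>' (cochain j n c (\<epsilon>'(v i := 0))))
      = coset (boundaries (ones K \<epsilon>') n) (face_sum v m c (ones K \<epsilon>'))"
    if \<epsilon>': "\<epsilon>' \<in> colourings (Suc j)" for \<epsilon>'
  proof -
    let ?I = "ones K \<epsilon>'" and ?A = "{i. i \<in> {1..m} \<and> v i \<in> ones K \<epsilon>'}"
    let ?t = "\<lambda>i. frag_cmul ((-1) ^ card {j \<in> {1..<i}. v j \<in> ?I}) (c (?I - {v i}))"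
    have A: "{i \<in> {1..card (vertex_set K)}. \<epsilon>' (v i) = 1} = ?A"
      using v_in by (auto simp: ones_def)
    have e: "edge_map K v 0 n i (\<epsilon>'(v i := 0)) \<epsilon>' (cochain j n c (\<epsilon>'(v i := 0))) = coset (boundaries ?I n) (?t i)"
      and t: "?t i \<in> cycles ?I n" if i: "i \<in> ?A" for i
    proof -
      have \<epsilon>: "\<epsilon>'(v i := 0) \<in> colourings j"
        using colouringsD[OF \<epsilon>'] i by (simp add: colourings_def colouring_length_eq bicolourings_update v_in ones_update card_Diff_singleton)
      have z: "c (?I - {v i}) \<in> cycles (?I - {v i}) n"
        using families_colouringsD[OF c \<epsilon>] by (simp add: ones_update)
      show "edge_map K v 0 n i (\<epsilon>'(v i := 0)) \<epsilon>' (cochain j n c (\<epsilon>'(v i := 0))) = coset (boundaries ?I n) (?t i)"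
        using edge_map_eq[OF colouringsD(1)[OF \<epsilon>'] _ z] i \<epsilon> by (simp add: cochain_def ones_update)
      show "?t i \<in> cycles ?I n"
        using z cycles_mono[of "?I - {v i}" ?I n] additive_subgroup_of_sign[OF additive_cycles] by blast
    qed
    interpret H: comm_group "homology ?I n"
      by (rule comm_group_homology)
    have "(\<Otimes>\<^bsub>homology ?I n\<^esub>i \<in> ?A. edge_map K v 0 n i (\<epsilon>'(v i := 0)) \<epsilon>' (cochain j n c (\<epsilon>'(v i := 0))))
        = (\<Otimes>\<^bsub>homology ?I n\<^esub>i \<in> ?A. coset (boundaries ?I n) (?t i))"
      using t by (intro H.finprod_cong') (auto simp: e carrier_additive_quotient[OF homology_simps])
    also have "\<dots> = coset (boundaries ?I n) (\<Sum>i\<in>?A. ?t i)"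
      by (rule finprod_additive_quotient(1)[OF homology_simps]) (use t in auto)
    finally show ?thesis
      unfolding A horizontal_homology_eq[OF colouringsD(1)[OF \<epsilon>']] by (simp add: face_sum_def)
  qed
  then show ?thesis
    unfolding uber_differential_def cochain_def[of "Suc j"] colourings_def[symmetric]
    by (intro restrict_ext)
qed

lemma group_hom_uber_differential:
  "group_hom (uber_cochain_group K v j 0 n) (uber_cochain_group K v (Suc j) 0 n) (uber_differential K v j 0 n)"
proof -
  have "uber_differential K v j 0 n \<in> hom (uber_cochain_group K v j 0 n) (uber_cochain_group K v (Suc j) 0 n)"
  proof (rule homI)
    fix x assume "x \<in> carrier (uber_cochain_group K v j 0 n)"
    then show "uber_differential K v j 0 n x \<in> carrier (uber_cochain_group K v (Suc j) 0 n)"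
      by (auto simp: carrier_uber_cochain_group uber_differential_cochain face_sum_families)
  next
    fix x y assume "x \<in> carrier (uber_cochain_group K v j 0 n)" "y \<in> carrier (uber_cochain_group K v j 0 n)"
    then obtain c c' where "c \<in> families j n" "x = cochain j n c" "c' \<in> families j n" "y = cochain j n c'"
      by (auto simp: carrier_uber_cochain_group)
    then show "uber_differential K v j 0 n (x \<otimes>\<^bsub>uber_cochain_group K v j 0 n\<^esub> y)
      = uber_differential K v j 0 n x \<otimes>\<^bsub>uber_cochain_group K v (Suc j) 0 n\<^esub> uber_differential K v j 0 n y"
      by (simp add: mult_uber_cochain_group uber_differential_cochain families_add face_sum_families face_sum_add[abs_def])
  qed
  then show ?thesis
    by (simp add: group_hom_def group_hom_axioms_def group_uber_cochain_group)
qed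

lemma uber_cocycles_eq:
  "uber_cocycles K v j 0 n = cochain j n ` {c \<in> families j n.
     \<forall>I\<subseteq>vertex_set K. card I = Suc j \<longrightarrow> face_sum v m c I \<in> boundaries I n}"
proof -
  have "uber_differential K v j 0 n (cochain j n c) = \<one>\<^bsub>uber_cochain_group K v (Suc j) 0 n\<^esub>
      \<longleftrightarrow> (\<forall>I\<subseteq>vertex_set K. card I = Suc j \<longrightarrow> face_sum v m c I \<in> boundaries I n)"
    if "c \<in> families j n" for c
    using that by (simp add: uber_differential_cochain one_uber_cochain_group cochain_eq_iff)
  then show ?thesis
    unfolding uber_cocycles_def kernel_def carrier_uber_cochain_group by auto
qed

lemma uber_coboundaries_Suc_eq:
  "uber_coboundaries K v (Suc j) 0 n = cochain (Suc j) n ` face_sum v m ` families j n"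
  by (auto simp: uber_coboundaries_def carrier_uber_cochain_group uber_differential_cochain image_image
    intro!: image_cong)

text \<open>The form in which all later computations use exactness: cocycle and coboundary equations
  between representatives, modulo the boundaries over each vertex set.\<close>

lemma trivial_group_uberhomology0_Suc_iff:
  "trivial_group (uberhomology0 K v (Suc j) n) \<longleftrightarrow>
    (\<forall>c\<in>families (Suc j) n.
       (\<forall>I\<subseteq>vertex_set K. card I = Suc (Suc j) \<longrightarrow> face_sum v m c I \<in> boundaries I n) \<longrightarrow>
       (\<exists>b\<in>families j n. \<forall>I\<subseteq>vertex_set K. card I = Suc j \<longrightarrow> c I - face_sum v m b I \<in> boundaries I n))"
proof -
  interpret C: comm_group "uber_cochain_group K v (Suc j) 0 n"
    by (rule comm_group_uber_cochain_group)
  have "subgroup (uber_cocycles K v (Suc j) 0 n) (uber_cochain_group K v (Suc j) 0 n)"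
    unfolding uber_cocycles_def by (rule group_hom.subgroup_kernel[OF group_hom_uber_differential])
  moreover have "subgroup (uber_coboundaries K v (Suc j) 0 n) (uber_cochain_group K v (Suc j) 0 n)"
    unfolding uber_coboundaries_def using group_hom.img_is_subgroup[OF group_hom_uber_differential] by simp
  \<comment> \<open>The double coboundary is 0 on representatives already, not just modulo
    boundaries.\<close>
  moreover have "uber_coboundaries K v (Suc j) 0 n \<subseteq> uber_cocycles K v (Suc j) 0 n"
    unfolding uber_coboundaries_Suc_eq uber_cocycles_eq
    by (intro image_mono) (auto simp: face_sum_families face_sum_face_sum[OF inj_v]
      additive_subgroup_ofD(1)[OF additive_boundaries])
  ultimately have "trivial_group (uberhomology0 K v (Suc j) n)
      \<longleftrightarrow> uber_cocycles K v (Suc j) 0 n \<subseteq> uber_coboundaries K v (Suc j) 0 n"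
    unfolding uberhomology0_def uberhomology_def by (rule C.trivial_group_quotient_iff)
  also have "\<dots> \<longleftrightarrow> (\<forall>c\<in>families (Suc j) n.
       (\<forall>I\<subseteq>vertex_set K. card I = Suc (Suc j) \<longrightarrow> face_sum v m c I \<in> boundaries I n) \<longrightarrow>
       (\<exists>b\<in>families j n. cochain (Suc j) n c = cochain (Suc j) n (face_sum v m b)))"
    unfolding uber_cocycles_eq uber_coboundaries_Suc_eq by (auto simp: image_iff)
  finally show ?thesis
    unfolding cochain_eq_iff .
qed

text \<open>The only vertex set of size 0 is empty, and there are no chains over it, so the cochain
  group itself is trivial.\<close>

lemma trivial_group_uberhomology0_0: "trivial_group (uberhomology0 K v 0 n)"
proof -
  interpret C: comm_group "uber_cochain_group K v 0 0 n"
    by (rule comm_group_uber_cochain_group)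
  have empty: "I = {}" if "I \<subseteq> vertex_set K" "card I = 0" for I
    using that finite_subset[OF that(1)] by auto
  have "faces {} n = {}"
    by (auto simp: faces_def)
  then have "chains {} n = {0}"
    by (simp add: chains_def)
  then have "cochain 0 n c = cochain 0 n (\<lambda>_. 0)" if "c \<in> families 0 n" for c
    using familiesD[OF that, of "{}"] additive_subgroup_ofD(1)[OF additive_boundaries]
    unfolding cochain_eq_iff by (auto dest!: empty simp: cycles_def)
  then have "carrier (uber_cochain_group K v 0 0 n) \<subseteq> uber_coboundaries K v 0 0 n"
    by (auto simp: uber_coboundaries_def one_uber_cochain_group carrier_uber_cochain_group)
  moreover have Z: "subgroup (uber_cocycles K v 0 0 n) (uber_cochain_group K v 0 0 n)"
    unfolding uber_cocycles_def by (rule group_hom.subgroup_kernel[OF group_hom_uber_differential])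
  moreover have "subgroup (uber_coboundaries K v 0 0 n) (uber_cochain_group K v 0 0 n)"
    unfolding uber_coboundaries_def by (simp add: C.triv_subgroup)
  moreover have "uber_coboundaries K v 0 0 n \<subseteq> uber_cocycles K v 0 0 n"
    unfolding uber_coboundaries_def using subgroup.one_closed[OF Z] by simp
  ultimately show ?thesis
    unfolding uberhomology0_def uberhomology_def
    by (subst C.trivial_group_quotient_iff) (auto dest: subgroup.mem_carrier)
qed

end

section \<open>Full simplices and minimal nonfaces\<close>

lemma face_sum_zero [simp]: "face_sum v m (\<lambda>_. 0) \<sigma> = 0"
  by (simp add: face_sum_def)

lemma face_sum_empty [simp]: "face_sum v m f {} = 0"
  by (simp add: face_sum_def)

text \<open>No sign is attached, which is correct when \<open>a\<close> comes first in the order. A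
  simplex already containing \<open>a\<close> has a degenerate cone, hence the value 0.\<close>

definition cone_over :: "'a \<Rightarrow> ('a set \<Rightarrow>\<^sub>0 int) \<Rightarrow> ('a set \<Rightarrow>\<^sub>0 int)" where
  "cone_over a = frag_extend (\<lambda>\<sigma>. if a \<in> \<sigma> then 0 else frag_of (insert a \<sigma>))"

context ordered_complex
begin

text \<open>Without \<open>v p\<close>, coning the faces cancels all of the boundary of the cone
  except \<sigma>. With \<open>v p\<close>, only the face opposite \<open>v p\<close> survives
  coning, and its cone is \<sigma>.\<close>

lemma red_cone_of:
  assumes p: "p \<in> {1..m}" and first: "\<And>i. i \<in> {1..<p} \<Longrightarrow> v i \<notin> \<sigma>"
  shows "red (cone_over (v p) (frag_of \<sigma>)) + cone_over (v p) (red (frag_of \<sigma>)) = frag_of \<sigma>"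
proof (cases "v p \<in> \<sigma>")
  case False
  have "cone_over (v p) (red (frag_of \<sigma>)) = face_sum v m (\<lambda>\<tau>. frag_of (insert (v p) \<tau>)) \<sigma>"
    unfolding red_of cone_over_def frag_extend_face_sum by (rule face_sum_cong) (use False in simp)
  moreover have "red (cone_over (v p) (frag_of \<sigma>)) = face_sum v m frag_of (insert (v p) \<sigma>)"
    using False by (simp add: cone_over_def)
  ultimately show ?thesis
    using face_sum_insert_first[OF inj_v p False first, of frag_of] by simp
next
  case True
  define \<tau> where "\<tau> = \<sigma> - {v p}"
  have \<tau>: "\<sigma> = insert (v p) \<tau>" "v p \<notin> \<tau>" "\<And>i. i \<in> {1..<p} \<Longrightarrow> v i \<notin> \<tau>"
    using True first by (auto simp: \<tau>_def)
  have "red (frag_of \<sigma>) = frag_of \<tau> - face_sum v m (\<lambda>\<rho>. frag_of (insert (v p) \<rho>)) \<tau>"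
    unfolding red_of \<tau>(1) by (rule face_sum_insert_first[OF inj_v p \<tau>(2,3)])
  then have "cone_over (v p) (red (frag_of \<sigma>)) = frag_of \<sigma>"
    using \<tau>(1,2) by (simp add: cone_over_def frag_extend_diff frag_extend_face_sum)
  then show ?thesis
    using True by (simp add: cone_over_def)
qed

text \<open>The identity lives in the span of all subsets of \<open>I\<close>, simplices of
  \<open>K\<close> or not, so it can also be applied to nonfaces.\<close>

lemma red_cone:
  assumes I: "I \<subseteq> vertex_set K" "I \<noteq> {}"
  shows "\<exists>a\<in>I. \<forall>c. Poly_Mapping.keys c \<subseteq> Pow I \<longrightarrow> red (cone_over a c) + cone_over a (red c) = c"
proof -
  \<comment> \<open>The cone point is the first vertex of \<open>I\<close>, as the unsigned cone
    requires.\<close>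
  define p where "p = (LEAST i. i \<in> {1..m} \<and> v i \<in> I)"
  have "\<exists>i. i \<in> {1..m} \<and> v i \<in> I"
    using I unfolding v_image[symmetric] by fast
  then have "p \<in> {1..m} \<and> v p \<in> I"
    unfolding p_def by (rule LeastI_ex)
  then have p: "p \<in> {1..m}" "v p \<in> I"
    by auto
  have first: "v i \<notin> I" if "i \<in> {1..<p}" for i
    using not_less_Least[of i "\<lambda>i. i \<in> {1..m} \<and> v i \<in> I"] that p(1) by (auto simp: p_def)
  have "red (cone_over (v p) c) + cone_over (v p) (red c) = c" if "Poly_Mapping.keys c \<subseteq> Pow I" for c
    using that
  proof (induction c rule: frag_induction)
    case zero
    then show ?case
      by (simp add: cone_over_def)
  next
    case (one \<sigma>)
    then show ?case
      using first by (intro red_cone_of p(1)) auto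
  next
    case (diff a b)
    then show ?case
      by (simp add: cone_over_def red_diff frag_extend_diff algebra_simps)
  qed
  then show ?thesis
    using p(2) by blast
qed

lemma chains_keys_Pow: "c \<in> chains I n \<Longrightarrow> Poly_Mapping.keys c \<subseteq> Pow I"
  by (auto simp: chains_def faces_def)

text \<open>The cone point lies in \<open>J\<close>, so both the cone of \<open>c\<close> and the
  cone of its vanishing boundary are 0.\<close>

lemma top_cycle_eq_0:
  assumes "J \<subseteq> vertex_set K" "J \<noteq> {}" "Poly_Mapping.keys c \<subseteq> {J}" "red c = 0"
  shows "c = 0"
proof -
  obtain a where a: "a \<in> J" "\<And>c. Poly_Mapping.keys c \<subseteq> Pow J \<Longrightarrow> red (cone_over a c) + cone_over a (red c) = c"
    using red_cone[OF assms(1,2)] by blast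
  have "cone_over a c = 0"
    unfolding cone_over_def using assms(3) a(1) by (intro frag_extend_eq_0) auto
  then show ?thesis
    using a(2)[of c] assms(3,4) by (auto simp: cone_over_def)
qed

lemma faces_top: "I \<subseteq> vertex_set K \<Longrightarrow> card I = Suc n \<Longrightarrow> faces I n \<subseteq> {I}"
  using card_subset_eq[OF finite_subset[OF _ finite_vertex_set], of I] by (auto simp: faces_def)

lemma chains_eq_0: "faces I n = {} \<Longrightarrow> chains I n = {0}"
  by (simp add: chains_def)

lemma boundaries_eq_0: "faces I (Suc n) = {} \<Longrightarrow> boundaries I n = {0}"
  by (simp add: boundaries_def chains_eq_0)

lemma faces_eq_empty:
  assumes "I \<subseteq> vertex_set K" "card I \<le> n"
  shows "faces I n = {}"
proof -
  have card_le: "card \<sigma> \<le> n" if "\<sigma> \<subseteq> I" for \<sigma>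
    using card_mono[OF finite_subset[OF assms(1) finite_vertex_set] that] assms(2) by simp
  show ?thesis
  proof (rule equals0I)
    fix \<sigma> assume "\<sigma> \<in> faces I n"
    then have "\<sigma> \<subseteq> I" "card \<sigma> = Suc n"
      by (auto simp: faces_def)
    then show False
      using card_le[of \<sigma>] by simp
  qed
qed

lemma red_boundaries: "c \<in> boundaries I n \<Longrightarrow> red c = 0"
  by (auto simp: boundaries_def)

lemma face_sum_singleton:
  "i \<in> {1..m} \<Longrightarrow> face_sum v m f {v i} = f {}"
  using face_sum_insert_first[OF inj_v, of i "{}" f] by simp

lemma face_sum_pair:
  assumes "p \<in> {1..m}" "q \<in> {1..m}" "p < q"
  shows "face_sum v m f {v p, v q} = f {v q} - f {v p}"
proof -
  have "v i \<notin> {v q}" if "i \<in> {1..p}" for i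
    using that assms inj_on_eq_iff[OF inj_v, of i q] by auto
  then show ?thesis
    using face_sum_insert_first[OF inj_v, of p "{v q}" f] face_sum_singleton[OF assms(2)] assms(1) by simp
qed

text \<open>Agrees with \<open>red\<close> on vertices but fixes the empty face, which
  \<open>red\<close> kills. Multiples of \<open>frag_of {}\<close> thus serve as a copy of the
  integers on which \<open>aug\<close> is the identity.\<close>

definition aug :: "('a set \<Rightarrow>\<^sub>0 int) \<Rightarrow> ('a set \<Rightarrow>\<^sub>0 int)" where
  "aug = frag_extend (\<lambda>_. frag_of {})"

lemma red_chains_0:
  assumes "c \<in> chains I 0"
  shows "red c = aug c"
  unfolding red_def aug_def
proof (rule frag_extend_eq)
  fix \<sigma> assume "\<sigma> \<in> Poly_Mapping.keys c"
  then have "\<sigma> \<subseteq> v ` {1..m}" "card \<sigma> = 1"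
    using assms simplex_subset[of \<sigma>] unfolding v_image by (auto simp: chains_def faces_def)
  then obtain i where "\<sigma> = {v i}" "i \<in> {1..m}"
    by (auto simp: card_1_singleton_iff)
  then show "face_sum v m frag_of \<sigma> = frag_of {}"
    by (simp add: face_sum_singleton)
qed

lemma aug_aug: "aug (aug c) = aug c"
  by (simp add: aug_def frag_extend_frag_extend)

lemma vertex_in: "x \<in> vertex_set K \<Longrightarrow> {x} \<in> K"
  using face_closed by (auto simp: vertex_set_def)

end

section \<open>Full simplices\<close>

locale ordered_simplex = ordered_complex +
  assumes full: "\<And>\<sigma>. \<sigma> \<subseteq> vertex_set K \<Longrightarrow> \<sigma> \<noteq> {} \<Longrightarrow> \<sigma> \<in> K"
    and nonempty: "m \<ge> 1"
begin

text \<open>For n = 0 the hypothesis \<open>red c = 0\<close> says that the augmentation vanishes.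
  The filling is the cone of \<open>c\<close>, whose simplices exist because every nonempty vertex
  set is one.\<close>

lemma simplex_acyclic:
  assumes I: "I \<subseteq> vertex_set K" and c: "c \<in> chains I n" "red c = 0"
  shows "c \<in> boundaries I n"
proof (cases "I = {}")
  case True
  then have "c = 0"
    using c(1) faces_eq_empty[of "{}" n] by (simp add: chains_def)
  then show ?thesis
    by (simp add: additive_subgroup_ofD(1)[OF additive_boundaries])
next
  case False
  then obtain a where a: "a \<in> I" "\<And>c. Poly_Mapping.keys c \<subseteq> Pow I \<Longrightarrow> red (cone_over a c) + cone_over a (red c) = c"
    using red_cone[OF I] by blast
  have "Poly_Mapping.keys (cone_over a c)
      \<subseteq> (\<Union>\<sigma>\<in>Poly_Mapping.keys c. Poly_Mapping.keys (if a \<in> \<sigma> then 0 else frag_of (insert a \<sigma>)))"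
    unfolding cone_over_def by (rule keys_frag_extend)
  also have "\<dots> \<subseteq> faces I (Suc n)"
  proof (rule UN_least)
    fix \<sigma> assume "\<sigma> \<in> Poly_Mapping.keys c"
    then have \<sigma>: "card \<sigma> = Suc n" "\<sigma> \<subseteq> I"
      using c(1) by (auto simp: chains_def faces_def)
    have "finite \<sigma>"
      using \<sigma>(1) by (auto intro: card_ge_0_finite)
    then have "insert a \<sigma> \<in> faces I (Suc n)" if "a \<notin> \<sigma>"
      using that \<sigma> a(1) I full[of "insert a \<sigma>"] by (auto simp: faces_def)
    then show "Poly_Mapping.keys (if a \<in> \<sigma> then 0 else frag_of (insert a \<sigma>)) \<subseteq> faces I (Suc n)"
      by simp
  qed
  finally have "cone_over a c \<in> chains I (Suc n)"
    by (simp add: chains_def)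
  moreover have "c = red (cone_over a c)"
    using a(2)[OF chains_keys_Pow[OF c(1)]] c(2) by (simp add: cone_over_def)
  ultimately show ?thesis
    unfolding boundaries_def by blast
qed

text \<open>Every component is a cycle of positive dimension and so a boundary already; the zero
  family is a primitive.\<close>

lemma uberhomology0_simplex_positive_dimension:
  "trivial_group (uberhomology0 K v (Suc j) (Suc n))"
proof -
  have "c I \<in> boundaries I (Suc n)" if "c \<in> families (Suc j) (Suc n)" "I \<subseteq> vertex_set K" "card I = Suc j" for c I
    using familiesD[OF that] by (intro simplex_acyclic that(2)) (auto simp: cycles_def)
  then show ?thesis
    unfolding trivial_group_uberhomology0_Suc_iff
    by (intro ballI impI bexI[of _ "\<lambda>_. 0"]) (auto simp: families_0)
qed

text \<open>Over each vertex set a class in dimension 0 is determined by its augmentation, so it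
  suffices to solve the problem for the augmentations of \<open>c\<close> and to lift the solution
  to 0-chains.\<close>

lemma uberhomology0_simplex_dimension_0:
  "trivial_group (uberhomology0 K v (Suc (Suc j)) 0)"
  unfolding trivial_group_uberhomology0_Suc_iff
proof (intro ballI impI)
  fix c assume c: "c \<in> families (Suc (Suc j)) 0"
    and cocycle: "\<forall>I\<subseteq>vertex_set K. card I = Suc (Suc (Suc j)) \<longrightarrow> face_sum v m c I \<in> boundaries I 0"
  let ?a = "v 1"
  have one: "1 \<in> {1..m}"
    using nonempty by simp
  define e where "e I = aug (c I)" for I
  \<comment> \<open>Contraction of the cube: evaluate after adding \<open>v 1\<close>, with value 0
    when it is already present.\<close>
  define b where "b I = (if ?a \<in> I then 0 else e (insert ?a I))" for I
  \<comment> \<open>The integer stored in \<open>b I\<close> is placed on one chosen vertex of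
    \<open>I\<close>.\<close>
  define y where "y I = frag_extend (\<lambda>_. frag_of {SOME x. x \<in> I}) (b I)" for I
  have c_chain: "c I \<in> chains I 0" "red (c I) = e I" if "I \<subseteq> vertex_set K" "card I = Suc (Suc j)" for I
    using familiesD[OF c that] red_chains_0 by (auto simp: cycles_def e_def)
  \<comment> \<open>Boundaries have augmentation 0, so the cocycle condition becomes an exact
    equation.\<close>
  have e_cocycle: "face_sum v m e I = 0" if I: "I \<subseteq> vertex_set K" "card I = Suc (Suc (Suc j))" for I
  proof -
    have "face_sum v m e I = face_sum v m (\<lambda>\<tau>. red (c \<tau>)) I"
    proof (rule face_sum_cong)
      fix i assume "i \<in> {1..m}" "v i \<in> I"
      then show "e (I - {v i}) = red (c (I - {v i}))"
        using I by (intro c_chain(2)[symmetric]) (auto simp: card_Diff_singleton)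
    qed
    then show ?thesis
      using red_boundaries[of "face_sum v m c I" I 0] cocycle I by (simp add: red_face_sum[symmetric])
  qed
  have b_e: "face_sum v m b I = e I" if I: "I \<subseteq> vertex_set K" "card I = Suc (Suc j)" for I
  proof (cases "?a \<in> I")
    case True
    define J where "J = I - {?a}"
    have J: "I = insert ?a J" "?a \<notin> J"
      using True by (auto simp: J_def)
    have "face_sum v m b I = b J - face_sum v m (\<lambda>\<tau>. b (insert ?a \<tau>)) J"
      unfolding J(1) by (rule face_sum_insert_first[OF inj_v one J(2)]) simp
    then show ?thesis
      using J by (simp add: b_def)
  next
    case False
    have "finite I"
      using I(1) finite_vertex_set by (rule finite_subset)
    \<comment> \<open>The cocycle equation one size up, expanded at its first vertex, exhibits
      \<open>e I\<close> as the coboundary of \<open>b\<close>.\<close>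
    then have "face_sum v m e (insert ?a I) = 0"
      using I False one by (intro e_cocycle) auto
    moreover have "face_sum v m e (insert ?a I) = e I - face_sum v m (\<lambda>\<tau>. e (insert ?a \<tau>)) I"
      by (rule face_sum_insert_first[OF inj_v one False]) simp
    moreover have "face_sum v m (\<lambda>\<tau>. e (insert ?a \<tau>)) I = face_sum v m b I"
      by (rule face_sum_cong) (use False in \<open>auto simp: b_def\<close>)
    ultimately show ?thesis
      by simp
  qed
  have y: "y J \<in> chains J 0" "red (y J) = b J" if J: "J \<subseteq> vertex_set K" "card J = Suc j" for J
  proof -
    \<comment> \<open>The size \<open>Suc j\<close> guarantees a vertex. Starting from degree 1, the
      lift would have to live over the empty set, where there is none.\<close>
    have "(SOME x. x \<in> J) \<in> J"
      using J(2) some_in_eq[of J] by force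
    then have "{SOME x. x \<in> J} \<in> faces J 0"
      using J(1) vertex_in by (auto simp: faces_def)
    moreover have "Poly_Mapping.keys (y J) \<subseteq> {{SOME x. x \<in> J}}"
      unfolding y_def by (rule order_trans[OF keys_frag_extend]) auto
    ultimately show chain: "y J \<in> chains J 0"
      by (auto simp: chains_def)
    have "aug (y J) = aug (b J)"
      by (simp add: y_def aug_def frag_extend_frag_extend)
    also have "\<dots> = b J"
      by (auto simp: b_def e_def aug_aug) (simp add: aug_def)
    finally show "red (y J) = b J"
      using red_chains_0[OF chain] by simp
  qed
  have y_fam: "y \<in> families (Suc j) 0"
    using y(1) by (simp add: families_def cycles_def)
  have "c I - face_sum v m y I \<in> boundaries I 0" if I: "I \<subseteq> vertex_set K" "card I = Suc (Suc j)" for I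
  proof (rule simplex_acyclic[OF I(1)])
    have "face_sum v m y I \<in> chains I 0"
      using familiesD[OF face_sum_families[OF y_fam] I] by (simp add: cycles_def)
    then show "c I - face_sum v m y I \<in> chains I 0"
      using c_chain(1)[OF I] additive_subgroup_ofD(2)[OF additive_chains] by blast
    have "red (face_sum v m y I) = face_sum v m b I"
      unfolding red_face_sum
    proof (rule face_sum_cong)
      fix i assume "i \<in> {1..m}" "v i \<in> I"
      then show "red (y (I - {v i})) = b (I - {v i})"
        using I by (intro y(2)) (auto simp: card_Diff_singleton)
    qed
    then show "red (c I - face_sum v m y I) = 0"
      using c_chain(2)[OF I] b_e[OF I] by (simp add: red_diff)
  qed
  then show "\<exists>b\<in>families (Suc j) 0. \<forall>I\<subseteq>vertex_set K. card I = Suc (Suc j) \<longrightarrow> c I - face_sum v m b I \<in> boundaries I 0"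
    using y_fam by blast
qed

text \<open>The class is that of \<open>frag_of\<close> on single vertices: over a pair its
  coboundary is the boundary of the edge. It is not a coboundary, since there are no chains over the
  empty set and no edges over a single vertex.\<close>

lemma uberhomology0_simplex_nontrivial: "\<not> trivial_group (uberhomology0 K v 1 0)"
proof
  assume "trivial_group (uberhomology0 K v 1 0)"
  then have exact: "\<exists>b\<in>families 0 0. \<forall>I\<subseteq>vertex_set K. card I = Suc 0 \<longrightarrow> c I - face_sum v m b I \<in> boundaries I 0"
    if "c \<in> families (Suc 0) 0"
      "\<forall>I\<subseteq>vertex_set K. card I = Suc (Suc 0) \<longrightarrow> face_sum v m c I \<in> boundaries I 0" for c
    using that unfolding One_nat_def trivial_group_uberhomology0_Suc_iff by blast
  have chain: "frag_of I \<in> chains I n" if "I \<subseteq> vertex_set K" "card I = Suc n" for I n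
    using full[of I] that by (cases "I = {}") (auto simp: chains_def faces_def)
  have "frag_of \<in> families (Suc 0) 0"
    using chain by (simp add: families_def cycles_def)
  moreover have "face_sum v m frag_of I \<in> boundaries I 0" if "I \<subseteq> vertex_set K" "card I = Suc (Suc 0)" for I
    unfolding boundaries_def red_of[symmetric] using chain[OF that] by (rule imageI)
  ultimately obtain b where b: "b \<in> families 0 0"
    "\<And>I. I \<subseteq> vertex_set K \<Longrightarrow> card I = Suc 0 \<Longrightarrow> frag_of I - face_sum v m b I \<in> boundaries I 0"
    using exact[of frag_of] by blast
  have v1: "1 \<in> {1..m}"
    using nonempty by simp
  have "b {} = 0"
    using familiesD[OF b(1), of "{}"] faces_eq_empty[of "{}" 0] by (simp add: cycles_def chains_def)
  then have "frag_of {v 1} \<in> boundaries {v 1} 0"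
    using b(2)[of "{v 1}"] v_in[OF v1] face_sum_singleton[OF v1, of b] by simp
  then show False
    using boundaries_eq_0[OF faces_eq_empty[of "{v 1}" "Suc 0"]] v_in[OF v1] by simp
qed

end

section \<open>Complexes with a missing face\<close>

context ordered_complex
begin

text \<open>A cocycle has the same augmentation at all vertices. Over the missing edge 0 is the only
  boundary, so the two components there are equal, yet supported on different vertices. They vanish,
  hence so does the common augmentation, and with it every component.\<close>

lemma uberhomology0_missing_edge:
  assumes e: "e \<subseteq> vertex_set K" "card e = 2" "e \<notin> K"
  shows "trivial_group (uberhomology0 K v 1 0)"
  unfolding One_nat_def trivial_group_uberhomology0_Suc_iff
proof (intro ballI impI)
  fix c assume c: "c \<in> families (Suc 0) 0"
    and cocycle: "\<forall>I\<subseteq>vertex_set K. card I = Suc (Suc 0) \<longrightarrow> face_sum v m c I \<in> boundaries I 0"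
  have c_keys: "Poly_Mapping.keys (c {v i}) \<subseteq> {{v i}}" if "i \<in> {1..m}" for i
    using familiesD[OF c, of "{v i}"] faces_top[of "{v i}" 0] v_in[OF that] by (auto simp: cycles_def chains_def)
  have diff: "c {v q} - c {v p} \<in> boundaries {v p, v q} 0"
    if "p \<in> {1..m}" "q \<in> {1..m}" "p < q" for p q
  proof -
    have "v p \<noteq> v q"
      using that inj_on_eq_iff[OF inj_v, of p q] by simp
    then show ?thesis
      using cocycle v_in[OF that(1)] v_in[OF that(2)] face_sum_pair[OF that, of c] by (metis (no_types, lifting) card_2_iff empty_subsetI insert_subset numeral_2_eq_2)
  qed
  have red_eq: "red (c {v q}) = red (c {v p})" if "p \<in> {1..m}" "q \<in> {1..m}" for p q
  proof (cases p q rule: linorder_cases)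
    case less
    then show ?thesis
      using red_boundaries[OF diff[of p q]] that by (simp add: red_diff)
  next
    case greater
    then show ?thesis
      using red_boundaries[OF diff[of q p]] that by (simp add: red_diff)
  qed simp
  obtain p q where pq: "p \<in> {1..m}" "q \<in> {1..m}" "p < q" "e = {v p, v q}"
  proof -
    obtain x y where xy: "e = {x, y}" "x \<noteq> y"
      using e(2) by (auto simp: card_2_iff)
    then have "x \<in> v ` {1..m}" "y \<in> v ` {1..m}"
      using e(1) by (simp_all only: v_image insert_subset)
    then obtain p q where v: "x = v p" "y = v q" "p \<in> {1..m}" "q \<in> {1..m}"
      by blast
    with xy(2) have "p \<noteq> q"
      by blast
    then have "p < q \<or> q < p"
      by (simp add: neq_iff)
    then show thesis
      using that[of p q] that[of q p] xy(1) v by (auto simp: insert_commute)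
  qed
  have "faces e (Suc 0) = {}"
    using faces_top[of e "Suc 0"] e by (auto simp: faces_def)
  then have eq: "c {v q} = c {v p}"
    using diff[OF pq(1-3)] boundaries_eq_0[of e 0] pq(4) by simp
  have "v p \<noteq> v q"
    using pq inj_on_eq_iff[OF inj_v, of p q] by simp
  then have "Poly_Mapping.keys (c {v p}) = {}"
    using c_keys[OF pq(1)] c_keys[OF pq(2)] unfolding eq by blast
  then have "c {v p} = 0"
    by simp
  then have "c {v i} = 0" if "i \<in> {1..m}" for i
    using red_eq[OF pq(1) that] top_cycle_eq_0[OF _ _ c_keys[OF that]] v_in[OF that] by simp
  then have "c I = 0" if "I \<subseteq> vertex_set K" "card I = Suc 0" for I
    using that unfolding v_image[symmetric] by (auto simp: card_1_singleton_iff)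
  then show "\<exists>b\<in>families 0 0. \<forall>I\<subseteq>vertex_set K. card I = Suc 0 \<longrightarrow> c I - face_sum v m b I \<in> boundaries I 0"
    by (intro bexI[of _ "\<lambda>_. 0"]) (auto simp: families_0 additive_subgroup_ofD(1)[OF additive_boundaries])
qed

text \<open>
  The cocycle consists of the boundaries of all \<open>(q + 2)\<close>-simplices, present in \<open>K\<close> or not.
\<close>

lemma uberhomology0_minimal_nonface:
  assumes N: "N \<subseteq> vertex_set K" "card N = Suc (Suc (Suc q))" "N \<notin> K"
    and skeleton: "\<And>\<sigma>. \<sigma> \<subseteq> vertex_set K \<Longrightarrow> card \<sigma> = Suc (Suc q) \<Longrightarrow> \<sigma> \<in> K"
  shows "\<not> trivial_group (uberhomology0 K v (Suc (Suc (Suc q))) (Suc q))"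
proof
  assume "trivial_group (uberhomology0 K v (Suc (Suc (Suc q))) (Suc q))"
  then have exact: "\<exists>b\<in>families (Suc (Suc q)) (Suc q). \<forall>I\<subseteq>vertex_set K. card I = Suc (Suc (Suc q)) \<longrightarrow>
      c I - face_sum v m b I \<in> boundaries I (Suc q)"
    if "c \<in> families (Suc (Suc (Suc q))) (Suc q)"
      "\<forall>I\<subseteq>vertex_set K. card I = Suc (Suc (Suc (Suc q))) \<longrightarrow> face_sum v m c I \<in> boundaries I (Suc q)" for c
    using that unfolding trivial_group_uberhomology0_Suc_iff by blast
  \<comment> \<open>Formally the coboundary of the diagonal family, hence closed. Each component is
    also the boundary of \<open>I\<close>, hence a cycle, even if \<open>I\<close> is not in
    \<open>K\<close>.\<close>
  let ?c = "face_sum v m (frag_of :: 'a set \<Rightarrow> _)"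
  have "?c I \<in> cycles I (Suc q)" if I: "I \<subseteq> vertex_set K" "card I = Suc (Suc (Suc q))" for I
  proof -
    have "Poly_Mapping.keys (?c I) \<subseteq> faces I (Suc q)"
    proof (rule order_trans[OF keys_face_sum], rule UN_least)
      fix i assume "i \<in> {i \<in> {1..m}. v i \<in> I}"
      then have "card (I - {v i}) = Suc (Suc q)" "I - {v i} \<subseteq> vertex_set K"
        using I by (auto simp: card_Diff_singleton)
      then show "Poly_Mapping.keys (frag_of (I - {v i})) \<subseteq> faces I (Suc q)"
        using skeleton by (auto simp: faces_def)
    qed
    moreover have "red (?c I) = 0"
      unfolding red_of[symmetric] by (rule red_red)
    ultimately show ?thesis
      by (simp add: cycles_def chains_def)
  qed
  then have "?c \<in> families (Suc (Suc (Suc q))) (Suc q)"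
    by (simp add: families_def)
  then obtain b where b: "b \<in> families (Suc (Suc q)) (Suc q)" "?c N - face_sum v m b N \<in> boundaries N (Suc q)"
    using exact[of ?c] N(1,2)
    by (auto simp: face_sum_face_sum[OF inj_v] additive_subgroup_ofD(1)[OF additive_boundaries])
  \<comment> \<open>A cycle of dimension \<open>q + 1\<close> on \<open>q + 2\<close> vertices is a
    multiple of a single simplex, so every candidate primitive is 0.\<close>
  have b_0: "b J = 0" if J: "J \<subseteq> vertex_set K" "card J = Suc (Suc q)" for J
  proof (rule top_cycle_eq_0[OF J(1)])
    show "J \<noteq> {}"
      using J(2) by auto
    show "Poly_Mapping.keys (b J) \<subseteq> {J}" "red (b J) = 0"
      using familiesD[OF b(1) J] subset_trans[OF _ faces_top[OF J]] by (simp_all add: cycles_def chains_def)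
  qed
  have "face_sum v m b N = face_sum v m (\<lambda>_. 0) N"
    using N(1,2) by (intro face_sum_cong b_0) (auto simp: card_Diff_singleton)
  \<comment> \<open>As \<open>N\<close> is missing, no simplex over \<open>N\<close> has its
    dimension, and the only boundary there is 0.\<close>
  moreover have "faces N (Suc (Suc q)) = {}"
    using faces_top[of N "Suc (Suc q)"] N by (auto simp: faces_def)
  ultimately have "red (frag_of N) = 0"
    using b(2) by (simp add: boundaries_eq_0)
  then show False
    using top_cycle_eq_0[OF N(1), of "frag_of N"] N(2) by (cases "N = {}") auto
qed

lemma minimal_nonface:
  assumes "\<sigma> \<subseteq> vertex_set K" "\<sigma> \<noteq> {}" "\<sigma> \<notin> K"
  obtains N q where "N \<subseteq> vertex_set K" "card N = Suc (Suc q)" "N \<notin> K"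
    "\<And>\<tau>. \<tau> \<subseteq> vertex_set K \<Longrightarrow> card \<tau> = Suc q \<Longrightarrow> \<tau> \<in> K"
proof -
  let ?P = "\<lambda>r. \<exists>N. N \<subseteq> vertex_set K \<and> N \<noteq> {} \<and> N \<notin> K \<and> card N = r"
  define r where "r = (LEAST r. ?P r)"
  have "\<exists>r. ?P r"
    using assms by blast
  then have "?P r"
    unfolding r_def by (rule LeastI_ex)
  then obtain N where N: "N \<subseteq> vertex_set K" "N \<noteq> {}" "N \<notin> K" "card N = r"
    by blast
  have min: "\<tau> \<in> K" if "\<tau> \<subseteq> vertex_set K" "\<tau> \<noteq> {}" "card \<tau> < r" for \<tau>
    using that not_less_Least[of "card \<tau>" ?P] unfolding r_def[symmetric] by blast
  have "finite N"
    using N(1) finite_vertex_set by (rule finite_subset)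
  \<comment> \<open>Nonemptiness excludes 0 and the absence of ghost vertices excludes 1, which
    yields the form \<open>Suc (Suc q)\<close>.\<close>
  then have "r \<noteq> 0"
    using N by auto
  moreover have "r \<noteq> 1"
    using N vertex_in by (auto simp: card_1_singleton_iff)
  ultimately obtain q where "r = Suc (Suc q)"
    by (metis One_nat_def not0_implies_Suc)
  then show thesis
    using that[of N q] N(1,3,4) min by (metis card.empty lessI nat.distinct(1))
qed

end

section \<open>Recognition of the full simplex\<close>

lemma vertex_set_full_simplex: "vertex_set (full_simplex n) = {0..n}"
  by (auto simp: vertex_set_def full_simplex_def)

text \<open>An isomorphism pulls every nonempty subset of \<open>{0..n}\<close> back to a simplex.
  Conversely, when all nonempty vertex sets are simplices, any bijection of the vertices will
  do.\<close>

lemma simplicial_isomorphic_full_simplex_iff: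
  assumes K: "finite_simplicial_complex K" and card: "card (vertex_set K) = Suc n"
  shows "simplicial_isomorphic K (full_simplex n) \<longleftrightarrow> (\<forall>\<sigma>\<subseteq>vertex_set K. \<sigma> \<noteq> {} \<longrightarrow> \<sigma> \<in> K)"
proof
  assume "simplicial_isomorphic K (full_simplex n)"
  then obtain f where f: "bij_betw f (vertex_set K) {0..n}" "(\<lambda>\<sigma>. f ` \<sigma>) ` K = full_simplex n"
    by (auto simp: simplicial_isomorphic_def vertex_set_full_simplex)
  show "\<forall>\<sigma>\<subseteq>vertex_set K. \<sigma> \<noteq> {} \<longrightarrow> \<sigma> \<in> K"
  proof (intro allI impI)
    fix \<sigma> assume \<sigma>: "\<sigma> \<subseteq> vertex_set K" "\<sigma> \<noteq> {}"
    then have "f ` \<sigma> \<in> full_simplex n"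
      using bij_betw_imp_surj_on[OF f(1)] by (auto simp: full_simplex_def)
    then obtain \<tau> where \<tau>: "\<tau> \<in> K" "f ` \<sigma> = f ` \<tau>"
      unfolding f(2)[symmetric] by blast
    have "\<tau> \<subseteq> vertex_set K"
      using \<tau>(1) by (auto simp: vertex_set_def)
    then have "\<sigma> = \<tau>"
      using inj_on_image_eq_iff[OF bij_betw_imp_inj_on[OF f(1)] \<sigma>(1)] \<tau>(2) by blast
    then show "\<sigma> \<in> K"
      using \<tau>(1) by simp
  qed
next
  assume full: "\<forall>\<sigma>\<subseteq>vertex_set K. \<sigma> \<noteq> {} \<longrightarrow> \<sigma> \<in> K"
  have K_eq: "K = Pow (vertex_set K) - {{}}"
    using K full by (auto simp: finite_simplicial_complex_def vertex_set_def)
  have "finite (vertex_set K)"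
    using card by (auto intro: card_ge_0_finite)
  then obtain f where f: "bij_betw f (vertex_set K) {0..n}"
    using finite_same_card_bij[of "vertex_set K" "{0..n}"] card by auto
  have "(\<lambda>\<sigma>. f ` \<sigma>) ` K = (\<lambda>\<sigma>. f ` \<sigma>) ` Pow (vertex_set K) - {{}}"
    by (subst K_eq) blast
  also have "\<dots> = full_simplex n"
    using image_Pow_surj[OF bij_betw_imp_surj_on[OF f]] by (simp add: full_simplex_def)
  finally show "simplicial_isomorphic K (full_simplex n)"
    unfolding simplicial_isomorphic_def vertex_set_full_simplex using f by blast
qed

theorem corollary3p13:
  fixes K :: "'a set set" and v :: "nat \<Rightarrow> 'a" and m :: nat
  assumes "finite_simplicial_complex K"
    and "m \<ge> 1"
    and "bij_betw v {1..m} (vertex_set K)"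
  shows "(\<not> trivial_group (uberhomology0 K v 1 0) \<and>
          (\<forall>j i. (j, i) \<noteq> (1, 0) \<longrightarrow> trivial_group (uberhomology0 K v j i)))
         \<longleftrightarrow> simplicial_isomorphic K (full_simplex (m - 1))"
proof -
  interpret ordered_complex K v m
    using assms(1,3) by unfold_locales
  have "simplicial_isomorphic K (full_simplex (m - 1)) \<longleftrightarrow> (\<forall>\<sigma>\<subseteq>vertex_set K. \<sigma> \<noteq> {} \<longrightarrow> \<sigma> \<in> K)"
    using assms(1,2) by (intro simplicial_isomorphic_full_simplex_iff) auto
  moreover have "\<forall>\<sigma>\<subseteq>vertex_set K. \<sigma> \<noteq> {} \<longrightarrow> \<sigma> \<in> K"
    if nontriv: "\<not> trivial_group (uberhomology0 K v 1 0)"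
      and triv: "\<And>j i. (j, i) \<noteq> (1, 0) \<Longrightarrow> trivial_group (uberhomology0 K v j i)"
  proof (rule ccontr)
    assume "\<not> ?thesis"
    then obtain N q where N: "N \<subseteq> vertex_set K" "card N = Suc (Suc q)" "N \<notin> K"
      "\<And>\<tau>. \<tau> \<subseteq> vertex_set K \<Longrightarrow> card \<tau> = Suc q \<Longrightarrow> \<tau> \<in> K"
      using minimal_nonface by metis
    show False
    \<comment> \<open>A missing edge contradicts nontriviality in degree 1 and dimension 0; a larger
      minimal nonface contradicts triviality in degree \<open>q + 2\<close> and dimension
      \<open>q\<close>.\<close>
    proof (cases q)
      case 0
      then show False
        using uberhomology0_missing_edge[of N] N nontriv by simp
    next
      case (Suc p)
      then show False
        using uberhomology0_minimal_nonface[of N p] N triv by simp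
    qed
  qed
  moreover have "\<not> trivial_group (uberhomology0 K v 1 0) \<and>
      (\<forall>j i. (j, i) \<noteq> (1, 0) \<longrightarrow> trivial_group (uberhomology0 K v j i))"
    if "\<forall>\<sigma>\<subseteq>vertex_set K. \<sigma> \<noteq> {} \<longrightarrow> \<sigma> \<in> K"
  proof -
    interpret ordered_simplex K v m
      using that assms(2) by unfold_locales auto
    have "trivial_group (uberhomology0 K v j i)" if "(j, i) \<noteq> (1, 0)" for j i
    proof (cases j)
      case 0
      then show ?thesis
        by (simp add: trivial_group_uberhomology0_0)
    next
      case (Suc l)
      show ?thesis
      proof (cases i)
        case 0
        \<comment> \<open>In dimension 0 the excluded degree is 1, so the degree is at least 2
          here.\<close>
        with Suc that obtain l' where "l = Suc l'"
          by (cases l) auto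
        then show ?thesis
          using Suc 0 uberhomology0_simplex_dimension_0 by simp
      next
        case (Suc n)
        then show ?thesis
          using \<open>j = Suc l\<close> uberhomology0_simplex_positive_dimension by simp
      qed
    qed
    then show ?thesis
      using uberhomology0_simplex_nontrivial by blast
  qed
  ultimately show ?thesis
    by blast
qed

end
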